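(* Let $K$ be a field, let $V$ be a $K$-vector space of finite dimension $n\ge 1$, and let $V_1,\dots,V_m$ ($m\ge 1$) be transversal linear subspaces of $V$, i.e. $c_S=\min\big(n,\sum_{i\in S}c_i\big)$ for all $S\subseteq\{1,\dots,m\}$. Let $I=I_1\cap\cdots\cap I_m$ and $J=I_1I_2\cdots I_m$, where $I_j\subseteq K[V]$ is the linear ideal of $V_j$. Then $\mathcal{H}(I,t)-f(t)$ and $\mathcal{H}(J,t)-f(t)$ are polynomials in $t$, where $$f(t)=\frac{\prod_{i=1}^m\big(1-(1-t)^{c_i}\big)}{(1-t)^n}.$$
   Context: $R=K[V]\cong K[x_1,\dots,x_n]$ is the polynomial coordinate ring of $V$ with its standard grading. $I_j\subseteq R$ is the ideal generated by the linear forms vanishing on $V_j$ (this is the vanishing ideal of $V_j$ when $K$ is infinite). For $S\subseteq\{1,\dots,m\}$, $V_S=\bigcap_{i\in S}V_i$ (with $V_\emptyset=V$), $c_S=n-\dim V_S$ is the codimension of $V_S$ in $V$, and $c_i=c_{\{i\}}=n-\dim V_i$. For a finitely generated graded $R$-module $M=\bigoplus_{d\in\mathbb{Z}} M_d$, the Hilbert series is $\mathcal{H}(M,t)=\sum_{d\in\mathbb{Z}}(\dim_K M_d)t^d$. *)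

theory Defs
  imports Complex_Main "HOL-Library.Poly_Mapping"
    "HOL-Computational_Algebra.Formal_Power_Series"
    "HOL-Computational_Algebra.Polynomial_FPS"
begin

text \<open>
  \<open>V\<close> is the type \<open>'v\<close> with scalar multiplication \<open>scale\<close> over the field \<open>'k\<close> and a basis
  \<open>b :: 'n \<Rightarrow> 'v\<close> indexed by a finite type \<open>'n\<close>, so that \<open>K[V]\<close> is the polynomial ring in the
  coordinate functions \<open>x\<^sub>i\<close> (\<open>i :: 'n\<close>) dual to \<open>b\<close>. A polynomial is a finitely supported
  map from exponent vectors to coefficients.
\<close>

type_synonym ('n, 'k) mpoly = "('n \<Rightarrow>\<^sub>0 nat) \<Rightarrow>\<^sub>0 'k"

definition const_poly :: "'k::field \<Rightarrow> ('n, 'k) mpoly" where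
  "const_poly c = Poly_Mapping.single 0 c"

definition var_poly :: "'n \<Rightarrow> ('n, 'k::field) mpoly" where
  "var_poly i = Poly_Mapping.single (Poly_Mapping.single i 1) 1"

definition poly_scale :: "'k::field \<Rightarrow> ('n, 'k) mpoly \<Rightarrow> ('n, 'k) mpoly" where
  "poly_scale c p = const_poly c * p"

lemma vector_space_poly_scale: "vector_space poly_scale"
  by unfold_locales
    (simp_all add: poly_scale_def const_poly_def algebra_simps single_add mult_single
      flip: mult.assoc)

definition homogeneous_part :: "nat \<Rightarrow> ('n::finite, 'k::field) mpoly set" where
  "homogeneous_part d =
     {p. \<forall>e\<in>Poly_Mapping.keys p. (\<Sum>i\<in>UNIV. Poly_Mapping.lookup e i) = d}"

text \<open>
  For a homogeneous ideal \<open>M\<close> of \<open>K[V]\<close>, the graded piece \<open>M\<^sub>d\<close> is the intersection of \<open>M\<close> with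
  the forms of degree \<open>d\<close>; it vanishes for \<open>d < 0\<close>, so the Hilbert series is a power series.
\<close>

definition hilbert_series :: "('n::finite, 'k::field) mpoly set \<Rightarrow> rat fps" where
  "hilbert_series M =
     Abs_fps (\<lambda>d. of_nat (vector_space.dim poly_scale (M \<inter> homogeneous_part d)))"

text \<open>Ideals of a commutative ring are its submodules under multiplication.\<close>

definition ideal_gen :: "'r::comm_ring_1 set \<Rightarrow> 'r set" where
  "ideal_gen A = module.span (*) A"

definition ideal_product :: "'i set \<Rightarrow> ('i \<Rightarrow> 'r::comm_ring_1 set) \<Rightarrow> 'r set" where
  "ideal_product A I = ideal_gen {\<Prod>i\<in>A. f i |f. \<forall>i\<in>A. f i \<in> I i}"

text \<open>The element of \<open>K[V]\<close> given by a linear form on \<open>V\<close>: one has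
  \<open>\<phi> = \<Sum>\<^sub>i \<phi>(b\<^sub>i) x\<^sub>i\<close> in the dual basis.\<close>

definition linear_form_poly :: "('n::finite \<Rightarrow> 'v) \<Rightarrow> ('v \<Rightarrow> 'k::field) \<Rightarrow> ('n, 'k) mpoly" where
  "linear_form_poly b \<phi> = (\<Sum>i\<in>UNIV. const_poly (\<phi> (b i)) * var_poly i)"

definition linear_ideal ::
  "('k::field \<Rightarrow> 'v::ab_group_add \<Rightarrow> 'v) \<Rightarrow> ('n::finite \<Rightarrow> 'v) \<Rightarrow> 'v set \<Rightarrow> ('n, 'k) mpoly set" where
  "linear_ideal scale b W =
     ideal_gen {linear_form_poly b \<phi> |\<phi>.
       Vector_Spaces.linear scale (*) \<phi> \<and> (\<forall>v\<in>W. \<phi> v = 0)}"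

definition codim :: "('k::field \<Rightarrow> 'v::ab_group_add \<Rightarrow> 'v) \<Rightarrow> 'v set \<Rightarrow> nat" where
  "codim scale W = vector_space.dim scale UNIV - vector_space.dim scale W"

definition transversal ::
  "('k::field \<Rightarrow> 'v::ab_group_add \<Rightarrow> 'v) \<Rightarrow> 'i set \<Rightarrow> ('i \<Rightarrow> 'v set) \<Rightarrow> bool" where
  "transversal scale A V \<longleftrightarrow>
     (\<forall>S\<subseteq>A. codim scale (\<Inter>i\<in>S. V i) =
        min (vector_space.dim scale UNIV) (\<Sum>i\<in>S. codim scale (V i)))"

end

theory Submission
  imports Defs "HOL-Library.Cardinality"
begin

text \<open>
  Let \<open>Q = I\<^sub>1 \<dots> I\<^sub>m\<close> be the product ideal. Two facts give the theorem: in all large degrees \<open>Q\<close>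
  agrees with the intersection \<open>I\<^sub>1 \<inter> \<dots> \<inter> I\<^sub>m\<close>, and the Hilbert series of \<open>Q\<close> is computed, up to
  a polynomial, by an induction on \<open>m\<close> that uses the first fact.

  Agreement in large degrees. Suppose first that the codimensions add up to at most \<open>n\<close>. Then
  the spaces \<open>L\<^sub>i\<close> of linear forms vanishing on the \<open>V\<^sub>i\<close> are independent, and \<open>Q\<close> equals the
  intersection: a projection of \<open>K[V]\<close> that kills the last group of variables and fixes the
  others shows that an element of \<open>I\<^sub>1 \<dots> I\<^bsub>m-1\<^esub>\<close> lying in \<open>I\<^sub>m\<close> lies in the product
  (\<open>product_ideal_mod_Int\<close>). If the codimensions add up to more than \<open>n\<close>, the \<open>L\<^sub>i\<close> together span
  all linear forms. For \<open>p\<close> in the intersection and \<open>w\<close> of degree \<open>m - 1\<close>, induction puts \<open>w p\<close>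
  into the product of all ideals but the \<open>i\<close>-th, so \<open>y w p \<in> Q\<close> for every \<open>y \<in> L\<^sub>i\<close>; as \<open>i\<close> varies,
  such \<open>y\<close> span the linear forms. Hence forms of degree \<open>m\<close> multiply the intersection into
  \<open>Q\<close> (\<open>homogeneous_part_mult_INT_subset_product\<close>). Since the intersection is generated in bounded
  degree (\<open>generated_in_bounded_degree\<close>, by Dickson's lemma applied to leading monomials), its
  elements of large degree are such multiples and lie in \<open>Q\<close>.

  Hilbert series. In large degrees \<open>Q\<close> is \<open>Q' \<inter> I\<^sub>m\<close> with \<open>Q' = I\<^sub>1 \<dots> I\<^bsub>m-1\<^esub>\<close>, so the modular law
  for dimensions gives \<open>H(Q) \<approx> H(Q') + H(I\<^sub>m) - H(Q' + I\<^sub>m)\<close>. Modulo \<open>I\<^sub>m\<close> the ideal \<open>Q' + I\<^sub>m\<close> is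
  the product ideal of the subspaces \<open>V\<^sub>i \<inter> V\<^sub>m\<close> of \<open>V\<^sub>m\<close>, again transversal but with \<open>m - 1\<close>
  members, so induction applies to both \<open>Q'\<close> and \<open>Q' + I\<^sub>m\<close> and yields
  \<open>F / (1 - t)\<^sup>n - F (1 - t)\<^sup>c / (1 - t)\<^sup>n\<close>, where \<open>F\<close> is the product of the first \<open>m - 1\<close> factors and
  \<open>c = c\<^sub>m\<close>. To avoid changing the ring, everything is done in \<open>K[V]\<close> relative to an ideal
  generated by a set \<open>L0\<close> of linear forms, that is for ideals \<open>I\<^sub>1 \<dots> I\<^sub>m + (L0)\<close>; passing to \<open>V\<^sub>m\<close>
  means replacing \<open>L0\<close> by \<open>L\<^sub>m \<union> L0\<close>.
\<close>

section \<open>Linear algebra\<close>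

context vector_space begin

lemma span_Int_span_Diff:
  assumes "independent D" "B \<subseteq> D"
  shows "span B \<inter> span (D - B) = {0}"
proof -
  have "x = 0" if x: "x \<in> span B" "x \<in> span (D - B)" for x
  proof -
    have "representation D x = representation B x" "representation D x = representation (D - B) x"
      using assms x by (auto intro!: representation_extend)
    then have "representation D x v = 0" for v
      using representation_ne_zero[of B x v] representation_ne_zero[of "D - B" x v]
      by (cases "v \<in> B") auto
    then show ?thesis
      using sum_nonzero_representation_eq[OF assms(1), of x] x span_mono[OF assms(2)] by auto
  qed
  then show ?thesis by (auto simp: span_zero)
qed

lemma independent_Un:
  assumes A: "independent A" and B: "independent B" and AB: "span A \<inter> span B = {0}"
  shows "independent (A \<union> B)"
proof -
  have disj: "A \<inter> B = {}"
  proof (rule ccontr)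
    assume "A \<inter> B \<noteq> {}"
    then obtain x where x: "x \<in> A" "x \<in> B" by blast
    then have "x \<in> span A \<inter> span B" by (simp add: span_base)
    then have "x = 0" using AB by simp
    then show False using x A dependent_zero by simp
  qed
  show ?thesis
    unfolding independent_explicit_finite_subsets
  proof (intro allI impI ballI)
    fix S u v assume S: "S \<subseteq> A \<union> B" "finite S" and 0: "(\<Sum>v\<in>S. u v *s v) = 0" and v: "v \<in> S"
    let ?a = "\<Sum>v\<in>S \<inter> A. u v *s v" and ?b = "\<Sum>v\<in>S \<inter> B. u v *s v"
    have "S = (S \<inter> A) \<union> (S \<inter> B)" using S by blast
    then have ab: "?a + ?b = 0"
      using 0 S disj sum.union_disjoint[of "S \<inter> A" "S \<inter> B" "\<lambda>v. u v *s v"] by auto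
    have a: "?a \<in> span A" and b: "?b \<in> span B"
      by (rule span_sum, simp add: span_scale span_base)+
    have "?a \<in> span B" using ab b by (metis add_eq_0_iff2 span_neg)
    with a AB have "?a = 0" by blast
    moreover from this ab have "?b = 0" by simp
    ultimately show "u v = 0"
      using v S independentD[OF A, of "S \<inter> A" u v] independentD[OF B, of "S \<inter> B" u v] by auto
  qed
qed

text \<open>
  Extend a basis \<open>B\<close> of \<open>S \<inter> T\<close> to a basis \<open>C\<close> of \<open>S\<close> and to a basis \<open>D\<close> of \<open>T\<close>. The union stays
  independent because a common element of \<open>S = span C\<close> and \<open>span (D - B) \<subseteq> T\<close> lies in
  \<open>S \<inter> T = span B\<close>, and \<open>span B\<close> meets \<open>span (D - B)\<close> only in \<open>0\<close>.
\<close>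

lemma adapted_bases:
  assumes S: "subspace S" and T: "subspace T"
  obtains C D where "independent (C \<union> D)" "span C = S" "span D = T" "span (C \<inter> D) = S \<inter> T"
proof -
  obtain B where B: "B \<subseteq> S \<inter> T" "independent B" "S \<inter> T \<subseteq> span B"
    using maximal_independent_subset by blast
  obtain C where C: "B \<subseteq> C" "C \<subseteq> S" "independent C" "S \<subseteq> span C"
    using maximal_independent_subset_extend[of B S] B by blast
  obtain D where D: "B \<subseteq> D" "D \<subseteq> T" "independent D" "T \<subseteq> span D"
    using maximal_independent_subset_extend[of B T] B by blast
  have sB: "span B = S \<inter> T"
    using B S T by (meson span_subspace subspace_inter)
  have sC: "span C = S" and sD: "span D = T"
    using C(2,4) D(2,4) S T by (metis span_subspace)+
  have BD: "span B \<inter> span (D - B) = {0}" using D by (intro span_Int_span_Diff)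
  have CD: "span C \<inter> span (D - B) = {0}"
  proof -
    have "span (D - B) \<subseteq> T" using sD span_mono[of "D - B" D] by blast
    then have "span C \<inter> span (D - B) \<subseteq> span B \<inter> span (D - B)" using sC sB by blast
    then show ?thesis using BD by (auto simp: span_zero)
  qed
  have "independent (C \<union> (D - B))"
    using C D CD independent_mono[OF D(3)] by (intro independent_Un) auto
  moreover have "C \<union> (D - B) = C \<union> D" using C by blast
  moreover have "C \<inter> D = B"
  proof -
    have "x = 0" if "x \<in> C" "x \<in> D - B" for x
      using that CD span_base[of x C] span_base[of x "D - B"] by blast
    moreover have "0 \<notin> D" using D dependent_zero by blast
    ultimately show ?thesis using C(1) D(1) by blast
  qed
  ultimately show ?thesis using that sB sC sD by metis
qed

lemma finite_independent_in_span:
  "independent B \<Longrightarrow> B \<subseteq> span F \<Longrightarrow> finite F \<Longrightarrow> finite B"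
  using independent_span_bound by blast

lemma dim_mono_finite:
  assumes "S \<subseteq> span T" "T \<subseteq> span F" "finite F"
  shows "dim S \<le> dim T"
proof -
  obtain B where B: "B \<subseteq> T" "independent B" "T \<subseteq> span B" "card B = dim T"
    using basis_exists by blast
  have "finite B" using B assms finite_independent_in_span by blast
  then show ?thesis
    using dim_le_card[of S B] B assms span_mono span_span by (metis order.trans span_minimal subspace_span)
qed

text \<open>
  The modular law. The ambient space may have infinite dimension, as \<open>K[V]\<close> has over \<open>K\<close>; only a
  finite set whose span contains both sets is asked for.
\<close>

lemma dim_Un_plus_dim_Int:
  assumes "finite F" "S \<subseteq> span F" "T \<subseteq> span F"
  shows "dim (S \<union> T) + dim (span S \<inter> span T) = dim S + dim T"
proof -
  obtain C D where CD: "independent (C \<union> D)" "span C = span S" "span D = span T"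
    "span (C \<inter> D) = span S \<inter> span T"
    using adapted_bases[of "span S" "span T"] by auto
  have "C \<union> D \<subseteq> span F"
    using CD assms span_superset by (metis Un_least order.trans span_minimal subspace_span)
  then have fin: "finite C" "finite D"
    using finite_independent_in_span[OF CD(1)] assms by auto
  have ind: "independent C" "independent D" "independent (C \<inter> D)"
    using independent_mono[OF CD(1)] by blast+
  have "span (C \<union> D) = span (S \<union> T)" using CD by (simp add: span_Un)
  then have "dim (S \<union> T) = card (C \<union> D)" "dim S = card C" "dim T = card D"
      "dim (span S \<inter> span T) = card (C \<inter> D)"
    using CD ind by (metis dim_span dim_span_eq_card_independent)+
  then show ?thesis using card_Un_Int[OF fin] by linarith
qed

lemma dim_equal_imp_span_eq:
  assumes "S \<subseteq> T" "T \<subseteq> span F" "finite F" "dim S = dim T"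
  shows "span S = span T"
proof -
  obtain B where B: "B \<subseteq> S" "independent B" "S \<subseteq> span B" "card B = dim S"
    using basis_exists by blast
  obtain C where C: "B \<subseteq> C" "C \<subseteq> T" "independent C" "T \<subseteq> span C"
    using maximal_independent_subset_extend[of B T] B assms by blast
  have "finite C" using C assms finite_independent_in_span by blast
  moreover have "card C = card B" using C B assms(4) by (metis basis_card_eq_dim)
  ultimately have "B = C" using C(1) card_subset_eq by metis
  then show ?thesis
    using B C assms by (metis span_mono span_minimal subspace_span subset_antisym span_span)
qed

lemma dim_injective_image:
  assumes "Vector_Spaces.linear scale scale g" "inj g"
  shows "dim (g ` S) = dim S"
proof -
  interpret g: Vector_Spaces.linear scale scale g by fact
  obtain B where B: "B \<subseteq> S" "independent B" "S \<subseteq> span B" "card B = dim S"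
    using basis_exists by blast
  have "independent (g ` B)"
    using B assms(2) g.independent_injective_image by (meson inj_on_subset subset_UNIV)
  moreover have "g ` S \<subseteq> span (g ` B)" using g.spans_image[OF B(3)] .
  ultimately have "dim (g ` S) = card (g ` B)" using dim_unique[OF image_mono[OF B(1)]] by blast
  then show ?thesis using B(4) assms(2) by (metis card_image inj_on_subset subset_UNIV)
qed

end

section \<open>The grading of the polynomial ring\<close>

text \<open>
  The ring \<open>K[V]\<close> is used as a vector space over \<open>K\<close>, with prefix \<open>P\<close>, and as a module over itself, with
  prefix \<open>ideal\<close>, whose submodules are the ideals.
\<close>

interpretation P: vector_space "poly_scale :: 'k::field \<Rightarrow> ('n, 'k) mpoly \<Rightarrow> _"
  by (rule vector_space_poly_scale)

interpretation ideal: module "(*) :: 'r::comm_ring_1 \<Rightarrow> 'r \<Rightarrow> 'r"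
  by unfold_locales (auto simp: algebra_simps)

(* Here scaling is the ring product, so this rule reverses associativity and makes rewriting
   with ring laws loop. *)
declare ideal.scale_scale [simp del]

lemma ideal_gen_eq_span: "ideal_gen = ideal.span"
  by (simp add: ideal_gen_def fun_eq_iff)

abbreviation mdeg :: "('n::finite \<Rightarrow>\<^sub>0 nat) \<Rightarrow> nat" where
  "mdeg e \<equiv> \<Sum>i\<in>UNIV. Poly_Mapping.lookup e i"

lemma mdeg_add: "mdeg (e + f) = mdeg e + mdeg f"
  by (simp add: lookup_add sum.distrib)

lemma mdeg_single: "mdeg (Poly_Mapping.single i k) = k"
  by (simp add: lookup_single when_def)

lemma lookup_poly_scale: "Poly_Mapping.lookup (poly_scale c p) e = c * Poly_Mapping.lookup p e"
proof -
  have "poly_scale c p = Poly_Mapping.map ((*) c) p"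
    by (simp add: poly_scale_def const_poly_def mult_map_scale_conv_mult)
  then show ?thesis by (simp add: Poly_Mapping.map.rep_eq when_def)
qed

lemma poly_scale_conv: "poly_scale c p = const_poly c * p"
  by (simp add: poly_scale_def)

lemma mpoly_eq_sum_monomials:
  "p = (\<Sum>e\<in>Poly_Mapping.keys p. Poly_Mapping.single e (Poly_Mapping.lookup p e))"
  by (rule poly_mapping_eqI)
    (simp add: lookup_sum lookup_single when_def in_keys_iff sum.delta')

lemma subspace_homogeneous_part:
  "P.subspace (homogeneous_part d :: ('n::finite, 'k::field) mpoly set)"
proof (rule P.subspaceI)
  fix x y :: "('n::finite, 'k::field) mpoly" and c :: 'k
  show "0 \<in> homogeneous_part d" by (simp add: homogeneous_part_def)
  assume x: "x \<in> homogeneous_part d"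
  show "poly_scale c x \<in> homogeneous_part d"
    using x by (auto simp: homogeneous_part_def in_keys_iff lookup_poly_scale)
  assume "y \<in> homogeneous_part d"
  with x show "x + y \<in> homogeneous_part d"
    using keys_add[of x y] by (auto simp: homogeneous_part_def)
qed

lemma homogeneous_part_mult:
  assumes "p \<in> homogeneous_part a" "q \<in> homogeneous_part b"
  shows "p * q \<in> homogeneous_part (a + b)"
  using assms keys_mult[of p q] by (fastforce simp: homogeneous_part_def mdeg_add)

lemma ideal_subspace_imp_subspace: "ideal.subspace X \<Longrightarrow> P.subspace X"
  by (auto intro!: P.subspaceI simp: poly_scale_conv ideal.subspace_0 ideal.subspace_add ideal.subspace_scale)

definition hom_comp :: "nat \<Rightarrow> ('n::finite, 'k::field) mpoly \<Rightarrow> ('n, 'k) mpoly" where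
  "hom_comp d p = (\<Sum>e | e \<in> Poly_Mapping.keys p \<and> mdeg e = d.
     Poly_Mapping.single e (Poly_Mapping.lookup p e))"

lemma lookup_hom_comp:
  "Poly_Mapping.lookup (hom_comp d p) e = (if mdeg e = d then Poly_Mapping.lookup p e else 0)"
  by (simp add: hom_comp_def lookup_sum lookup_single when_def in_keys_iff sum.delta')

lemma hom_comp_in: "hom_comp d p \<in> homogeneous_part d"
  by (auto simp: homogeneous_part_def in_keys_iff lookup_hom_comp split: if_splits)

lemma hom_comp_add: "hom_comp d (p + q) = hom_comp d p + hom_comp d q"
  by (rule poly_mapping_eqI) (simp add: lookup_hom_comp lookup_add)

lemma hom_comp_0 [simp]: "hom_comp d 0 = 0"
  by (rule poly_mapping_eqI) (simp add: lookup_hom_comp)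

lemma hom_comp_sum: "hom_comp d (sum f A) = (\<Sum>x\<in>A. hom_comp d (f x))"
  by (induction A rule: infinite_finite_induct) (simp_all add: hom_comp_add)

lemma hom_comp_eq: "p \<in> homogeneous_part a \<Longrightarrow> hom_comp d p = (if a = d then p else 0)"
  by (rule poly_mapping_eqI) (force simp: lookup_hom_comp homogeneous_part_def in_keys_iff)

lemma sum_hom_comp: "p = (\<Sum>d \<in> mdeg ` Poly_Mapping.keys p. hom_comp d p)"
proof (rule poly_mapping_eqI)
  fix e
  show "Poly_Mapping.lookup p e = Poly_Mapping.lookup (\<Sum>d \<in> mdeg ` Poly_Mapping.keys p. hom_comp d p) e"
    by (auto simp: lookup_sum lookup_hom_comp in_keys_iff sum.delta image_iff)
qed

lemma hom_comp_mult:
  assumes "g \<in> homogeneous_part a"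
  shows "hom_comp d (p * g) = (if a \<le> d then hom_comp (d - a) p * g else 0)"
proof -
  have "p * g = (\<Sum>k \<in> mdeg ` Poly_Mapping.keys p. hom_comp k p * g)"
    by (subst sum_hom_comp[of p]) (rule sum_distrib_right)
  then have "hom_comp d (p * g) = (\<Sum>k \<in> mdeg ` Poly_Mapping.keys p. hom_comp d (hom_comp k p * g))"
    by (simp add: hom_comp_sum)
  also have "\<dots> = (\<Sum>k \<in> mdeg ` Poly_Mapping.keys p. if k + a = d then hom_comp k p * g else 0)"
    by (intro sum.cong refl hom_comp_eq homogeneous_part_mult hom_comp_in assms)
  also have "\<dots> = (\<Sum>k \<in> mdeg ` Poly_Mapping.keys p. if k = d - a then if a \<le> d then hom_comp (d - a) p * g else 0 else 0)"
    by (intro sum.cong) auto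
  also have "\<dots> = (if a \<le> d then hom_comp (d - a) p * g else 0)"
  proof (cases "d - a \<in> mdeg ` Poly_Mapping.keys p")
    case False
    then have "hom_comp (d - a) p = 0"
      by (intro poly_mapping_eqI) (metis (mono_tags) image_eqI in_keys_iff lookup_hom_comp lookup_zero)
    then show ?thesis by (simp add: sum.delta')
  qed (simp add: sum.delta')
  finally show ?thesis .
qed

definition homogeneous_ideal :: "('n::finite, 'k::field) mpoly set \<Rightarrow> bool" where
  "homogeneous_ideal X \<longleftrightarrow> ideal.subspace X \<and> (\<forall>p\<in>X. \<forall>d. hom_comp d p \<in> X)"

lemma homogeneous_ideal_gen:
  assumes "\<And>g. g \<in> G \<Longrightarrow> \<exists>a. g \<in> homogeneous_part a"
  shows "homogeneous_ideal (ideal_gen G)"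
proof -
  have "hom_comp d p \<in> ideal.span G" if "p \<in> ideal.span G" for p d
    using that
  proof (induction rule: ideal.span_induct_alt)
    case base then show ?case by (simp add: ideal.span_zero)
  next
    case (step c g y)
    obtain a where a: "g \<in> homogeneous_part a" using assms step by blast
    show ?case using step
      by (simp add: hom_comp_add hom_comp_mult[OF a] ideal.span_add ideal.span_scale ideal.span_base)
  qed
  then show ?thesis by (simp add: homogeneous_ideal_def ideal_gen_eq_span)
qed

text \<open>
  A sum of homogeneous ideals is formed degree by degree, because the component of degree \<open>d\<close> of
  \<open>x + y\<close> is the sum of those of \<open>x\<close> and \<open>y\<close>. This reduces sums of ideals to linear algebra in the
  finite-dimensional graded pieces.
\<close>

lemma span_Un_homogeneous:
  assumes "homogeneous_ideal X" "homogeneous_ideal Y"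
  shows "P.span (X \<inter> homogeneous_part d \<union> Y \<inter> homogeneous_part d) =
    ideal_gen (X \<union> Y) \<inter> homogeneous_part d"
proof -
  have X: "ideal.subspace X" and Y: "ideal.subspace Y"
    using assms by (auto simp: homogeneous_ideal_def)
  have sub: "P.subspace (X \<inter> homogeneous_part d)" "P.subspace (Y \<inter> homogeneous_part d)"
    using X Y by (simp_all add: P.subspace_inter subspace_homogeneous_part ideal_subspace_imp_subspace)
  have "x + y \<in> ideal_gen (X \<union> Y) \<inter> homogeneous_part d"
    if "x \<in> X \<inter> homogeneous_part d" "y \<in> Y \<inter> homogeneous_part d" for x y
    using that P.subspace_add[OF subspace_homogeneous_part, of x d y]
    by (simp add: ideal_gen_eq_span ideal.span_add ideal.span_base)
  moreover have "\<exists>x y. p = x + y \<and> x \<in> X \<inter> homogeneous_part d \<and> y \<in> Y \<inter> homogeneous_part d"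
    if p: "p \<in> ideal_gen (X \<union> Y)" "p \<in> homogeneous_part d" for p
  proof -
    have "ideal.span X = X" "ideal.span Y = Y" using X Y by simp_all
    then have "p \<in> {x + y |x y. x \<in> X \<and> y \<in> Y}"
      using p(1) unfolding ideal_gen_eq_span ideal.span_Un by (simp only:)
    then obtain x y where xy: "p = x + y" "x \<in> X" "y \<in> Y" by blast
    have "p = hom_comp d x + hom_comp d y"
      using p xy by (metis hom_comp_add hom_comp_eq)
    moreover have "hom_comp d x \<in> X \<inter> homogeneous_part d" "hom_comp d y \<in> Y \<inter> homogeneous_part d"
      using assms xy(2,3) by (auto simp: homogeneous_ideal_def hom_comp_in)
    ultimately show ?thesis by blast
  qed
  ultimately show ?thesis
    using sub by (auto simp: P.span_Un P.span_eq_iff[THEN iffD2])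
qed

lemma var_poly_power: "var_poly i ^ k = Poly_Mapping.single (Poly_Mapping.single i k) 1"
  by (induction k) (simp_all add: var_poly_def mult_single single_add[symmetric])

lemma exponent_eq_sum: "e = (\<Sum>i\<in>UNIV. Poly_Mapping.single i (Poly_Mapping.lookup e i))"
  for e :: "'n::finite \<Rightarrow>\<^sub>0 nat"
  by (rule poly_mapping_eqI) (simp add: lookup_sum lookup_single when_def)

lemma monomial_eq_prod_vars:
  "Poly_Mapping.single e (c::'k::field) = const_poly c * (\<Prod>i\<in>UNIV. var_poly i ^ Poly_Mapping.lookup e i)"
  for e :: "'n::finite \<Rightarrow>\<^sub>0 nat"
proof -
  have "(\<Prod>i\<in>A. var_poly i ^ Poly_Mapping.lookup e i) =
    Poly_Mapping.single (\<Sum>i\<in>A. Poly_Mapping.single i (Poly_Mapping.lookup e i)) (1::'k)" if "finite A" for A :: "'n set"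
    using that by induction (simp_all add: var_poly_power mult_single)
  from this[of UNIV] show ?thesis
    by (simp add: const_poly_def mult_single exponent_eq_sum[symmetric])
qed

lemma mpoly_induct [case_names const var add mult]:
  fixes p :: "('n::finite, 'k::field) mpoly"
  assumes "\<And>c. Q (const_poly c)" "\<And>i. Q (var_poly i)"
    "\<And>p q. Q p \<Longrightarrow> Q q \<Longrightarrow> Q (p + q)" "\<And>p q. Q p \<Longrightarrow> Q q \<Longrightarrow> Q (p * q)"
  shows "Q p"
proof -
  have 0: "Q 0" and 1: "Q 1"
    using assms(1)[of 0] assms(1)[of 1] by (simp_all add: const_poly_def)
  have pow: "Q q \<Longrightarrow> Q (q ^ k)" for q k by (induction k) (auto intro: 1 assms(4))
  have "Q (\<Prod>i\<in>A. var_poly i ^ k i)" if "finite A" for A k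
    using that by induction (auto intro: 1 pow assms(2,4))
  then have mono: "Q (Poly_Mapping.single e c)" for e c
    unfolding monomial_eq_prod_vars by (intro assms) auto
  have "Q (\<Sum>e\<in>A. Poly_Mapping.single e (c e))" if "finite A" for A c
    using that by induction (auto intro: 0 assms(3) mono)
  then have "Q (\<Sum>e\<in>Poly_Mapping.keys p. Poly_Mapping.single e (Poly_Mapping.lookup p e))" by simp
  then show ?thesis by (simp flip: mpoly_eq_sum_monomials)
qed

lemma finite_mdeg: "finite {e :: 'n::finite \<Rightarrow>\<^sub>0 nat. mdeg e = d}"
proof (rule finite_imageD[of Poly_Mapping.lookup])
  have "Poly_Mapping.lookup ` {e :: 'n \<Rightarrow>\<^sub>0 nat. mdeg e = d} \<subseteq> Pi\<^sub>E UNIV (\<lambda>_. {..d})"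
    by (auto intro!: member_le_sum)
  then show "finite (Poly_Mapping.lookup ` {e :: 'n \<Rightarrow>\<^sub>0 nat. mdeg e = d})"
    by (rule finite_subset) (auto intro!: finite_PiE)
next
  show "inj_on Poly_Mapping.lookup {e :: 'n \<Rightarrow>\<^sub>0 nat. mdeg e = d}"
    by (rule inj_onI) (simp add: poly_mapping.lookup_inject)
qed

lemma single_in_homogeneous_part: "mdeg e = d \<Longrightarrow> Poly_Mapping.single e c \<in> homogeneous_part d"
  by (auto simp: homogeneous_part_def)

definition monomials :: "nat \<Rightarrow> ('n::finite, 'k::field) mpoly set" where
  "monomials d = (\<lambda>e. Poly_Mapping.single e 1) ` {e. mdeg e = d}"

lemma finite_monomials: "finite (monomials d)"
  by (simp add: monomials_def finite_mdeg)

lemma poly_scale_single: "poly_scale c (Poly_Mapping.single e a) = Poly_Mapping.single e (c * a)"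
  by (simp add: poly_scale_def const_poly_def mult_single)

lemma homogeneous_part_eq_span: "homogeneous_part d = P.span (monomials d)"
proof (intro subset_antisym subsetI)
  fix p :: "('a, 'b) mpoly" assume p: "p \<in> homogeneous_part d"
  have "(\<Sum>e\<in>Poly_Mapping.keys p. poly_scale (Poly_Mapping.lookup p e) (Poly_Mapping.single e 1)) \<in> P.span (monomials d)"
    using p by (intro P.span_sum P.span_scale P.span_base) (auto simp: monomials_def homogeneous_part_def)
  then show "p \<in> P.span (monomials d)"
    by (simp add: poly_scale_single flip: mpoly_eq_sum_monomials)
next
  have "P.span (monomials d) \<subseteq> homogeneous_part d"
    by (intro P.span_minimal subspace_homogeneous_part) (auto simp: monomials_def single_in_homogeneous_part)
  then show "x \<in> P.span (monomials d) \<Longrightarrow> x \<in> homogeneous_part d" for x :: "('a, 'b) mpoly"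
    by blast
qed

lemma var_poly_in: "var_poly i \<in> homogeneous_part 1"
  unfolding var_poly_def by (rule single_in_homogeneous_part) (simp add: mdeg_single[simplified])

lemma mdeg_Suc_split:
  assumes "mdeg e = Suc d"
  obtains i f where "e = Poly_Mapping.single i 1 + f" "mdeg f = d"
proof -
  have "\<exists>i. Poly_Mapping.lookup e i \<noteq> 0"
  proof (rule ccontr)
    assume "\<not> ?thesis" then show False using assms by simp
  qed
  then obtain i where i: "Poly_Mapping.lookup e i \<noteq> 0" by blast
  let ?f = "e - Poly_Mapping.single i 1"
  have "e = Poly_Mapping.single i 1 + ?f"
    using i by (intro poly_mapping_eqI) (auto simp: lookup_add lookup_minus lookup_single when_def)
  moreover from this have "mdeg ?f = d"
    using assms mdeg_add[of "Poly_Mapping.single i 1" ?f] mdeg_single[of i 1] by simp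
  ultimately show ?thesis using that by blast
qed

lemma homogeneous_part_Suc:
  "homogeneous_part (Suc d) = P.span {x * w | x w. x \<in> homogeneous_part 1 \<and> w \<in> homogeneous_part d}"
    (is "_ = P.span ?M")
proof (rule subset_antisym)
  have "monomials (Suc d) \<subseteq> ?M"
  proof (clarsimp simp: monomials_def)
    fix e :: "'a \<Rightarrow>\<^sub>0 nat" assume "mdeg e = Suc d"
    then obtain i f where "e = Poly_Mapping.single i 1 + f" "mdeg f = d" by (rule mdeg_Suc_split)
    then have "Poly_Mapping.single e (1::'b) = var_poly i * Poly_Mapping.single f 1"
      by (simp add: var_poly_def mult_single)
    then show "\<exists>x w. Poly_Mapping.single e (1::'b) = x * w \<and> x \<in> homogeneous_part (Suc 0) \<and> w \<in> homogeneous_part d"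
      using var_poly_in[of i] single_in_homogeneous_part[OF \<open>mdeg f = d\<close>] by auto
  qed
  then show "(homogeneous_part (Suc d) :: ('a, 'b) mpoly set) \<subseteq> P.span ?M"
    unfolding homogeneous_part_eq_span by (rule P.span_mono)
  show "P.span ?M \<subseteq> (homogeneous_part (Suc d) :: ('a, 'b) mpoly set)"
    using homogeneous_part_mult[of _ 1 _ d]
    by (intro P.span_minimal subspace_homogeneous_part) auto
qed

lemma linear_form_in_span_vars:
  fixes v :: "('n::finite, 'k::field) mpoly"
  assumes "v \<in> homogeneous_part 1"
  shows "v \<in> P.span (range var_poly)"
proof -
  have "monomials (Suc 0) \<subseteq> (range var_poly :: ('n, 'k) mpoly set)"
  proof (clarsimp simp: monomials_def)
    fix e :: "'n \<Rightarrow>\<^sub>0 nat" assume "mdeg e = Suc 0"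
    then obtain i f where e: "e = Poly_Mapping.single i 1 + f" "mdeg f = 0" by (rule mdeg_Suc_split)
    then have "f = 0" by (intro poly_mapping_eqI) auto
    with e show "Poly_Mapping.single e (1::'k) \<in> range var_poly" by (auto simp: var_poly_def)
  qed
  then show ?thesis using assms P.span_mono by (auto simp: homogeneous_part_eq_span)
qed

lemma independent_monomials: "P.independent (monomials d :: ('n::finite, 'k::field) mpoly set)"
  unfolding P.dependent_def
proof clarify
  fix a :: "('n, 'k) mpoly" assume a: "a \<in> monomials d" "a \<in> P.span (monomials d - {a})"
  then obtain e where e: "a = Poly_Mapping.single e 1" by (auto simp: monomials_def)
  have "P.span (monomials d - {a}) \<subseteq> {p. Poly_Mapping.lookup p e = 0}"
  proof (rule P.span_minimal)
    show "P.subspace {p :: ('n, 'k) mpoly. Poly_Mapping.lookup p e = 0}"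
      by (rule P.subspaceI) (simp_all add: lookup_add lookup_poly_scale)
    show "monomials d - {a} \<subseteq> {p. Poly_Mapping.lookup p e = 0}"
      by (auto simp: monomials_def e lookup_single when_def)
  qed
  then show False using a(2) by (auto simp: e)
qed

lemma homogeneous_part_1_eq_span: "homogeneous_part 1 = P.span (range var_poly)"
proof (rule subset_antisym)
  show "homogeneous_part 1 \<subseteq> P.span (range var_poly)" using linear_form_in_span_vars by blast
  show "P.span (range var_poly) \<subseteq> homogeneous_part 1"
    using var_poly_in by (intro P.span_minimal subspace_homogeneous_part) blast
qed

lemma inj_var_poly: "inj (var_poly :: 'n \<Rightarrow> ('n, 'k::field) mpoly)"
proof (rule injI)
  fix i j :: 'n assume "var_poly i = (var_poly j :: ('n, 'k) mpoly)"
  then have "Poly_Mapping.keys (var_poly i :: ('n, 'k) mpoly) = Poly_Mapping.keys (var_poly j :: ('n, 'k) mpoly)"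
    by simp
  then have "Poly_Mapping.keys (Poly_Mapping.single i (1::nat)) = Poly_Mapping.keys (Poly_Mapping.single j (1::nat))"
    unfolding var_poly_def by simp
  then show "i = j" by simp
qed

lemma independent_var_poly: "P.independent (range (var_poly :: 'n::finite \<Rightarrow> ('n, 'k::field) mpoly))"
proof (rule P.independent_mono[OF independent_monomials[of 1]])
  show "range (var_poly :: 'n \<Rightarrow> ('n, 'k) mpoly) \<subseteq> monomials 1"
    using mdeg_single[of _ 1] by (auto simp: var_poly_def monomials_def)
qed

lemma dim_homogeneous_part_1: "P.dim (homogeneous_part 1 :: ('n::finite, 'k::field) mpoly set) = CARD('n)"
  unfolding homogeneous_part_1_eq_span P.dim_span_eq_card_independent[OF independent_var_poly]
  by (simp add: card_image inj_var_poly)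

section \<open>Projections onto fewer variables\<close>

text \<open>The \<open>K\<close>-algebra endomorphism of \<open>K[V]\<close> that sends the variable \<open>x\<^sub>i\<close> to \<open>y i\<close>.\<close>

definition subst :: "('n::finite \<Rightarrow> ('n, 'k::field) mpoly) \<Rightarrow> ('n, 'k) mpoly \<Rightarrow> ('n, 'k) mpoly" where
  "subst y p = (\<Sum>e\<in>Poly_Mapping.keys p.
     const_poly (Poly_Mapping.lookup p e) * (\<Prod>i\<in>UNIV. y i ^ Poly_Mapping.lookup e i))"

lemma const_poly_add: "const_poly (a + b) = const_poly a + const_poly b"
  by (simp add: const_poly_def single_add)

lemma const_poly_mult: "const_poly (a * b) = const_poly a * const_poly b"
  by (simp add: const_poly_def mult_single)

lemma const_poly_0 [simp]: "const_poly 0 = 0" and const_poly_1 [simp]: "const_poly 1 = 1"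
  by (simp_all add: const_poly_def)

lemma subst_superset:
  assumes "finite A" "Poly_Mapping.keys p \<subseteq> A"
  shows "subst y p = (\<Sum>e\<in>A. const_poly (Poly_Mapping.lookup p e) * (\<Prod>i\<in>UNIV. y i ^ Poly_Mapping.lookup e i))"
  unfolding subst_def using assms by (intro sum.mono_neutral_left) (auto simp: in_keys_iff)

lemma subst_add: "subst y (p + q) = subst y p + subst y q"
proof -
  let ?A = "Poly_Mapping.keys p \<union> Poly_Mapping.keys q"
  show ?thesis
    using keys_add[of p q]
    by (simp add: subst_superset[of ?A] lookup_add const_poly_add distrib_right sum.distrib)
qed

lemma subst_0 [simp]: "subst y 0 = 0" by (simp add: subst_def)

lemma subst_sum: "subst y (sum f A) = (\<Sum>x\<in>A. subst y (f x))"
  by (induction A rule: infinite_finite_induct) (simp_all add: subst_add)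

lemma subst_single: "subst y (Poly_Mapping.single e c) = const_poly c * (\<Prod>i\<in>UNIV. y i ^ Poly_Mapping.lookup e i)"
  by (cases "c = 0") (simp_all add: subst_def)

lemma subst_mult: "subst y (p * q) = subst y p * subst y q"
proof -
  have 1: "subst y (Poly_Mapping.single e a * Poly_Mapping.single f b) =
    subst y (Poly_Mapping.single e a) * subst y (Poly_Mapping.single f b)" for e f a b
    by (simp only: mult_single subst_single lookup_add power_add prod.distrib const_poly_mult) (simp only: mult_ac)
  have "p * q = (\<Sum>e\<in>Poly_Mapping.keys p. \<Sum>f\<in>Poly_Mapping.keys q.
      Poly_Mapping.single e (Poly_Mapping.lookup p e) * Poly_Mapping.single f (Poly_Mapping.lookup q f))"
    by (simp flip: sum_product mpoly_eq_sum_monomials)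
  also have "subst y \<dots> = (\<Sum>e\<in>Poly_Mapping.keys p. subst y (Poly_Mapping.single e (Poly_Mapping.lookup p e))) *
     (\<Sum>f\<in>Poly_Mapping.keys q. subst y (Poly_Mapping.single f (Poly_Mapping.lookup q f)))"
    by (simp add: subst_sum 1 sum_product)
  also have "\<dots> = subst y p * subst y q"
    by (simp flip: subst_sum mpoly_eq_sum_monomials)
  finally show ?thesis .
qed

lemma subst_const [simp]: "subst y (const_poly c) = const_poly c"
  unfolding const_poly_def by (simp add: subst_single const_poly_def)

lemma subst_var [simp]: "subst y (var_poly i) = y i"
proof -
  have "(\<Prod>j\<in>UNIV. y j ^ Poly_Mapping.lookup (Poly_Mapping.single i 1) j) = (\<Prod>j\<in>UNIV. if j = i then y i else 1)"
    by (intro prod.cong) (auto simp: lookup_single when_def)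
  then show ?thesis by (simp add: var_poly_def subst_single)
qed

definition ring_endomorphism :: "('r::semiring_1 \<Rightarrow> 'r) \<Rightarrow> bool" where
  "ring_endomorphism h \<longleftrightarrow>
     (\<forall>p q. h (p + q) = h p + h q) \<and> (\<forall>p q. h (p * q) = h p * h q) \<and> h 1 = 1"

text \<open>
  In the coordinates \<open>E\<close>, setting the variables in \<open>D\<close> to zero is a ring endomorphism. On linear
  forms it is the linear map that kills \<open>D\<close> and fixes \<open>E - D\<close>, and it changes any polynomial only by
  an element of the ideal \<open>(D)\<close>: this holds for constants and linear forms, and
  \<open>p q - h p h q = h q (p - h p) + p (q - h q)\<close> carries it over to products.
\<close>

lemma coordinate_projection:
  fixes E D :: "('n::finite, 'k::field) mpoly set"
  assumes E: "P.independent E" "E \<subseteq> homogeneous_part 1" "homogeneous_part 1 \<subseteq> P.span E" and D: "D \<subseteq> E"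
  obtains h where "ring_endomorphism h" "\<forall>v\<in>P.span (E - D). h v = v" "\<forall>v\<in>D. h v = 0"
    "\<forall>p. p - h p \<in> ideal_gen D"
proof -
  interpret PP: vector_space_pair "poly_scale :: 'k \<Rightarrow> ('n, 'k) mpoly \<Rightarrow> _" "poly_scale :: 'k \<Rightarrow> ('n, 'k) mpoly \<Rightarrow> _" ..
  obtain g where g: "Vector_Spaces.linear poly_scale poly_scale g"
    and gE: "\<forall>x\<in>E. g x = (if x \<in> D then 0 else x)"
    using PP.linear_independent_extend[OF E(1), of "\<lambda>x. if x \<in> D then 0 else x"] by auto
  interpret g: Vector_Spaces.linear poly_scale poly_scale g by (rule g)
  define h where "h = subst (\<lambda>i. g (var_poly i))"
  have hg: "h v = g v" if "v \<in> homogeneous_part 1" for v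
    using linear_form_in_span_vars[OF that]
    by (induction rule: P.span_induct_alt)
      (auto simp: h_def subst_add subst_mult g.add g.scale[unfolded poly_scale_conv] poly_scale_conv g.zero)
  have hadd: "h (p + q) = h p + h q" and hmult: "h (p * q) = h p * h q" for p q
    by (simp_all add: h_def subst_add subst_mult)
  have hc: "h (const_poly c) = const_poly c" for c by (simp add: h_def)
  show thesis
  proof
    show "ring_endomorphism h" using hc[of 1] by (simp add: ring_endomorphism_def hadd hmult)
    have "g v = v" if "v \<in> P.span (E - D)" for v
      using that by (induction rule: P.span_induct_alt) (use gE in \<open>auto simp: g.zero g.add g.scale\<close>)
    moreover have "P.span (E - D) \<subseteq> homogeneous_part 1"
      using E by (intro P.span_minimal subspace_homogeneous_part) auto
    ultimately show "\<forall>v\<in>P.span (E - D). h v = v" using hg by auto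
    show "\<forall>v\<in>D. h v = 0"
    proof
      fix v assume that: "v \<in> D"
      have "v \<in> E" "v \<in> homogeneous_part 1" using that D E(2) by blast+
      then show "h v = 0" using that gE hg by metis
    qed
    have "p - h p \<in> ideal_gen D" for p
    proof (induction p rule: mpoly_induct)
      case (const c) then show ?case by (simp add: hc ideal_gen_eq_span ideal.span_zero)
    next
      case (var i)
      have "var_poly i \<in> P.span E" using E(3) var_poly_in by blast
      then have "var_poly i - g (var_poly i) \<in> ideal_gen D"
      proof (induction rule: P.span_induct_alt)
        case base then show ?case by (simp add: g.zero ideal_gen_eq_span ideal.span_zero)
      next
        case (step c x y)
        have "x - g x \<in> ideal.span D" using gE step(1) by (auto simp: ideal.span_base ideal.span_zero)
        then have "const_poly c * (x - g x) + (y - g y) \<in> ideal.span D"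
          using step(2) by (simp add: ideal_gen_eq_span ideal.span_add ideal.span_scale)
        then show ?case
          unfolding poly_scale_conv g.add g.scale[unfolded poly_scale_conv] ideal_gen_eq_span
          by (simp add: algebra_simps)
      qed
      then show ?case using hg var_poly_in by metis
    next
      case (add p q)
      then have "(p - h p) + (q - h q) \<in> ideal_gen D" by (simp add: ideal_gen_eq_span ideal.span_add)
      then show ?case by (simp add: hadd algebra_simps)
    next
      case (mult p q)
      then have "h q * (p - h p) + p * (q - h q) \<in> ideal_gen D"
        by (simp add: ideal_gen_eq_span ideal.span_add ideal.span_scale)
      then show ?case by (simp add: hmult algebra_simps)
    qed
    then show "\<forall>p. p - h p \<in> ideal_gen D" by blast
  qed
qed

section \<open>Leading monomials\<close>

text \<open>
  The index type of the variables carries no order. An additive injection into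
  \<open>nat \<Rightarrow>\<^sub>0 nat\<close> pulls back the linear order there, which is compatible with addition, and so
  provides a monomial order on \<open>K[V]\<close>. Any such injection will do, hence the choice operator.
\<close>

definition monomial_rank :: "('n::finite \<Rightarrow>\<^sub>0 nat) \<Rightarrow> (nat \<Rightarrow>\<^sub>0 nat)" where
  "monomial_rank = (SOME r. inj r \<and> (\<forall>e f. r (e + f) = r e + r f))"

lemma monomial_rank: "inj monomial_rank" "monomial_rank (e + f) = monomial_rank e + monomial_rank f"
proof -
  obtain h :: "'n::finite \<Rightarrow> nat" where h: "inj h"
    using finite_imp_inj_to_nat_seg[of "UNIV :: 'n set"] by auto
  let ?r = "\<lambda>e. \<Sum>i\<in>UNIV. Poly_Mapping.single (h i) (Poly_Mapping.lookup e i)"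
  have lookup: "Poly_Mapping.lookup (?r e) (h j) = Poly_Mapping.lookup e j" for e j
  proof -
    have "Poly_Mapping.lookup (?r e) (h j) = (\<Sum>i\<in>UNIV. if i = j then Poly_Mapping.lookup e j else 0)"
      unfolding lookup_sum using h by (intro sum.cong) (auto simp: lookup_single when_def inj_eq)
    then show ?thesis by simp
  qed
  have "inj ?r"
  proof (rule injI)
    fix e f assume "?r e = ?r f"
    then show "e = f" using lookup[of e] lookup[of f] by (intro poly_mapping_eqI) metis
  qed
  moreover have "?r (e + f) = ?r e + ?r f" for e f
    by (simp add: lookup_add single_add sum.distrib)
  ultimately have "\<exists>r :: ('n \<Rightarrow>\<^sub>0 nat) \<Rightarrow> (nat \<Rightarrow>\<^sub>0 nat). inj r \<and> (\<forall>e f. r (e + f) = r e + r f)" by blast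
  from someI_ex[OF this]
  have *: "inj (monomial_rank :: ('n \<Rightarrow>\<^sub>0 nat) \<Rightarrow> _) \<and>
      (\<forall>e f :: 'n \<Rightarrow>\<^sub>0 nat. monomial_rank (e + f) = monomial_rank e + monomial_rank f)"
    unfolding monomial_rank_def .
  show "inj (monomial_rank :: ('n \<Rightarrow>\<^sub>0 nat) \<Rightarrow> _)" using * by blast
  show "monomial_rank (e + f) = monomial_rank e + monomial_rank f" for e f :: "'n \<Rightarrow>\<^sub>0 nat" using * by blast
qed

definition is_leading :: "('n::finite, 'k::field) mpoly \<Rightarrow> ('n \<Rightarrow>\<^sub>0 nat) \<Rightarrow> bool" where
  "is_leading p e \<longleftrightarrow> e \<in> Poly_Mapping.keys p \<and>
     (\<forall>f\<in>Poly_Mapping.keys p. monomial_rank f \<le> monomial_rank e)"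

lemma ex_leading:
  assumes "p \<noteq> 0"
  obtains e where "is_leading p e"
proof -
  have "Poly_Mapping.keys p \<noteq> {}" using assms by simp
  then have "Max (monomial_rank ` Poly_Mapping.keys p) \<in> monomial_rank ` Poly_Mapping.keys p"
    by (intro Max_in) auto
  then obtain e where "e \<in> Poly_Mapping.keys p" "Max (monomial_rank ` Poly_Mapping.keys p) = monomial_rank e"
    by auto
  then have "is_leading p e" unfolding is_leading_def by (metis Max_ge finite_imageI finite_keys imageI)
  then show ?thesis by (rule that)
qed

text \<open>
  Only the product of the two leading terms contributes to the exponent \<open>e + f\<close>: exponents below
  \<open>e\<close> and \<open>f\<close>, not both equal to them, have a strictly smaller sum.
\<close>

lemma lookup_mult_leading:
  assumes p: "is_leading p e" and q: "is_leading q f"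
  shows "Poly_Mapping.lookup (p * q) (e + f) = Poly_Mapping.lookup p e * Poly_Mapping.lookup q f"
proof -
  have eq: "a = e \<and> b = f" if "a \<in> Poly_Mapping.keys p" "b \<in> Poly_Mapping.keys q" "a + b = e + f" for a b
  proof -
    have le: "monomial_rank a \<le> monomial_rank e" "monomial_rank b \<le> monomial_rank f"
      using p q that by (auto simp: is_leading_def)
    have sum: "monomial_rank a + monomial_rank b = monomial_rank e + monomial_rank f"
      using that(3) by (metis monomial_rank(2))
    have "\<not> monomial_rank a < monomial_rank e"
      using add_less_le_mono[OF _ le(2), of "monomial_rank a" "monomial_rank e"] sum by auto
    with le(1) have "monomial_rank a = monomial_rank e" by simp
    then have "a = e" by (rule injD[OF monomial_rank(1)])
    then show ?thesis using that(3) by simp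
  qed
  have "p * q = (\<Sum>a\<in>Poly_Mapping.keys p. \<Sum>b\<in>Poly_Mapping.keys q.
      Poly_Mapping.single a (Poly_Mapping.lookup p a) * Poly_Mapping.single b (Poly_Mapping.lookup q b))"
    by (simp flip: sum_product mpoly_eq_sum_monomials)
  then have "Poly_Mapping.lookup (p * q) (e + f) = (\<Sum>a\<in>Poly_Mapping.keys p. \<Sum>b\<in>Poly_Mapping.keys q.
      if a + b = e + f then Poly_Mapping.lookup p a * Poly_Mapping.lookup q b else 0)"
    by (simp add: lookup_sum mult_single lookup_single when_def)
  also have "\<dots> = (\<Sum>a\<in>Poly_Mapping.keys p. \<Sum>b\<in>Poly_Mapping.keys q.
      if a = e then if b = f then Poly_Mapping.lookup p e * Poly_Mapping.lookup q f else 0 else 0)"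
    using eq by (intro sum.cong refl) auto
  also have "\<dots> = (\<Sum>a\<in>Poly_Mapping.keys p. if a = e then Poly_Mapping.lookup p e * Poly_Mapping.lookup q f else 0)"
    using q by (intro sum.cong refl) (auto simp: is_leading_def sum.delta)
  also have "\<dots> = Poly_Mapping.lookup p e * Poly_Mapping.lookup q f"
    using p by (simp add: is_leading_def sum.delta)
  finally show ?thesis .
qed

lemma mpoly_no_zero_divisors:
  fixes p q :: "('n::finite, 'k::field) mpoly"
  assumes "p * q = 0" "p \<noteq> 0" shows "q = 0"
proof (rule ccontr)
  assume "q \<noteq> 0"
  then obtain f where f: "is_leading q f" by (rule ex_leading)
  obtain e where e: "is_leading p e" using assms(2) by (rule ex_leading)
  have "Poly_Mapping.lookup p e * Poly_Mapping.lookup q f = 0"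
    using lookup_mult_leading[OF e f] assms(1) by simp
  then show False using e f by (auto simp: is_leading_def in_keys_iff)
qed

lemma is_leading_var_mult:
  assumes "is_leading q f"
  shows "is_leading (var_poly i * q) (Poly_Mapping.single i 1 + f)"
proof -
  have v: "is_leading (var_poly i :: ('a, 'b) mpoly) (Poly_Mapping.single i 1)"
    by (simp add: is_leading_def var_poly_def)
  have "Poly_Mapping.single i 1 + f \<in> Poly_Mapping.keys (var_poly i * q)"
    unfolding in_keys_iff lookup_mult_leading[OF v assms] using v assms
    by (simp add: is_leading_def in_keys_iff)
  moreover have "monomial_rank g \<le> monomial_rank (Poly_Mapping.single i 1 + f)"
    if g: "g \<in> Poly_Mapping.keys (var_poly i * q)" for g
  proof -
    obtain b where b: "g = Poly_Mapping.single i 1 + b" "b \<in> Poly_Mapping.keys q"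
      using g keys_mult[of "var_poly i" q] by (auto simp: var_poly_def)
    then show ?thesis using assms by (simp add: monomial_rank(2) is_leading_def add_left_mono)
  qed
  ultimately show ?thesis by (simp add: is_leading_def)
qed

text \<open>
  A monotone subsequence exists in any linear order; if it is decreasing, it becomes constant once
  it has reached its least value, and a tail of it is increasing as well.
\<close>

lemma nat_seq_mono_subseq:
  fixes s :: "nat \<Rightarrow> nat"
  shows "\<exists>r :: nat \<Rightarrow> nat. strict_mono r \<and> mono (\<lambda>n. s (r n))"
proof -
  obtain r where r: "strict_mono (r :: nat \<Rightarrow> nat)" "monoseq (\<lambda>n. s (r n))"
    using seq_monosub[of s] by blast
  show ?thesis
  proof (cases "mono (\<lambda>n. s (r n))")
    case True then show ?thesis using r(1) by blast
  next
    case False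
    then have dec: "\<And>m n. m \<le> n \<Longrightarrow> s (r n) \<le> s (r m)"
      using r(2) by (auto simp: monoseq_def mono_def)
    define v where "v = (LEAST v. v \<in> range (s \<circ> r))"
    have "v \<in> range (s \<circ> r)" unfolding v_def by (rule LeastI[of _ "s (r 0)"]) auto
    then obtain N where N: "s (r N) = v" by auto
    have "s (r n) = v" if "n \<ge> N" for n
      using dec[OF that] N Least_le[of "\<lambda>v. v \<in> range (s \<circ> r)" "s (r n)"] by (auto simp: v_def)
    then have "mono (\<lambda>n. s (r (N + n)))" by (simp add: mono_def)
    moreover have "strict_mono (\<lambda>n. r (N + n))" using r(1) by (simp add: strict_mono_def)
    ultimately show ?thesis by blast
  qed
qed

text \<open>
  Dickson's lemma: an infinite set of exponents contains two distinct ones, of which one divides the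
  other. Passing to subsequences, one coordinate at a time, makes an injective sequence in \<open>S\<close>
  increasing in every coordinate.
\<close>

lemma dickson:
  fixes S :: "('n::finite \<Rightarrow>\<^sub>0 nat) set"
  assumes "infinite S"
  obtains e f where "e \<in> S" "e + f \<in> S" "f \<noteq> 0"
proof -
  obtain s :: "nat \<Rightarrow> 'n \<Rightarrow>\<^sub>0 nat" where s: "inj s" "range s \<subseteq> S"
    using infinite_countable_subset[OF assms] by blast
  have "\<exists>r :: nat \<Rightarrow> nat. strict_mono r \<and> (\<forall>i\<in>B. mono (\<lambda>n. Poly_Mapping.lookup (s (r n)) i))" if "finite B" for B
    using that
  proof induction
    case empty show ?case by (auto intro!: exI[of _ "\<lambda>n. n"] simp: strict_mono_def)
  next
    case (insert j B)
    then obtain r :: "nat \<Rightarrow> nat" where r: "strict_mono r" "\<forall>i\<in>B. mono (\<lambda>n. Poly_Mapping.lookup (s (r n)) i)" by blast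
    obtain r' :: "nat \<Rightarrow> nat" where r': "strict_mono r'" "mono (\<lambda>n. Poly_Mapping.lookup (s (r (r' n))) j)"
      using nat_seq_mono_subseq[of "\<lambda>n. Poly_Mapping.lookup (s (r n)) j"] by blast
    have "strict_mono (r \<circ> r')" using r(1) r'(1) by (rule strict_mono_o)
    moreover have "mono (\<lambda>n. Poly_Mapping.lookup (s ((r \<circ> r') n)) i)" if "i \<in> insert j B" for i
    proof (cases "i = j")
      case True then show ?thesis using r'(2) by (simp add: o_def)
    next
      case False
      then have "mono (\<lambda>n. Poly_Mapping.lookup (s (r n)) i)" using that r(2) by blast
      moreover have "mono r'" using r'(1) by (rule strict_mono_mono)
      ultimately show ?thesis by (auto simp: mono_def)
    qed
    ultimately show ?case by blast
  qed
  from this[of UNIV] obtain r :: "nat \<Rightarrow> nat" where r: "strict_mono r" "\<And>i. mono (\<lambda>n. Poly_Mapping.lookup (s (r n)) i)" by auto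
  let ?f = "s (r 1) - s (r 0)"
  have eq: "s (r 0) + ?f = s (r 1)"
    using r(2) by (intro poly_mapping_eqI) (simp add: lookup_add lookup_minus mono_def)
  have "r 0 \<noteq> r 1" using r(1) by (metis less_irrefl strict_monoD zero_less_one)
  then have "s (r 0) \<noteq> s (r 1)" using s(1) by (simp add: inj_eq)
  then have "?f \<noteq> 0" using eq by auto
  then show ?thesis using that[of "s (r 0)" ?f] eq s(2) by auto
qed

lemma exponent_split:
  fixes f :: "'n::finite \<Rightarrow>\<^sub>0 nat"
  assumes "f \<noteq> 0"
  obtains i g where "f = Poly_Mapping.single i 1 + g"
proof -
  have "mdeg f \<noteq> 0" using assms by (auto intro: poly_mapping_eqI)
  then obtain d where "mdeg f = Suc d" using not0_implies_Suc by blast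
  then show ?thesis using mdeg_Suc_split that by metis
qed

text \<open>
  The graded form of Hilbert's basis theorem. Let \<open>M\<close> be the set of leading exponents of forms in
  \<open>X\<close>. Its elements that are minimal for divisibility, collected in \<open>M0\<close>, are finite in number by
  Dickson's lemma. Above their degrees every leading exponent is a variable times another one, so
  subtracting a variable times an element of \<open>X\<close> cancels the leading term of a given form in \<open>X\<close>;
  this is repeated until nothing is left.
\<close>

lemma generated_in_bounded_degree:
  fixes X :: "('n::finite, 'k::field) mpoly set"
  assumes X: "ideal.subspace X"
  obtains D where "\<And>d. d \<ge> D \<Longrightarrow> X \<inter> homogeneous_part (Suc d) \<subseteq>
    P.span {x * q | x q. x \<in> homogeneous_part 1 \<and> q \<in> X \<inter> homogeneous_part d}"
proof -
  define M where "M = {e. \<exists>p \<in> X \<inter> homogeneous_part (mdeg e). is_leading p e}"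
  define M0 where "M0 = {e \<in> M. \<not> (\<exists>i. \<exists>f\<in>M. e = Poly_Mapping.single i 1 + f)}"
  have M_Suc: "Poly_Mapping.single i 1 + e \<in> M" if e: "e \<in> M" for i e
  proof -
    obtain p where p: "p \<in> X" "p \<in> homogeneous_part (mdeg e)" "is_leading p e"
      using e by (auto simp: M_def)
    have "var_poly i * p \<in> homogeneous_part (1 + mdeg e)"
      using var_poly_in p(2) by (rule homogeneous_part_mult)
    moreover have "mdeg (Poly_Mapping.single i 1 + e) = 1 + mdeg e"
      unfolding mdeg_add mdeg_single ..
    ultimately show ?thesis
      using p X is_leading_var_mult[OF p(3)] ideal.subspace_scale[OF X p(1)] by (auto simp: M_def)
  qed
  have M_add: "e + f \<in> M" if "e \<in> M" for e f
    using that
  proof (induction "mdeg f" arbitrary: e f)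
    case 0
    then have "f = 0" by (intro poly_mapping_eqI) auto
    then show ?case using 0 by simp
  next
    case (Suc d)
    obtain i g where ig: "f = Poly_Mapping.single i 1 + g" "mdeg g = d"
      using mdeg_Suc_split[OF Suc(2)[symmetric]] by blast
    then have "(Poly_Mapping.single i 1 + e) + g \<in> M" using Suc M_Suc by metis
    then show ?case using ig by (simp add: add_ac)
  qed
  have "finite M0"
  proof (rule ccontr)
    assume "infinite M0"
    then obtain e f where ef: "e \<in> M0" "e + f \<in> M0" "f \<noteq> 0" by (rule dickson)
    then obtain i g where g: "f = Poly_Mapping.single i 1 + g" using exponent_split by blast
    have "e + f = Poly_Mapping.single i 1 + (e + g)" using g by (simp add: add_ac)
    moreover have "e + g \<in> M" using ef(1) by (intro M_add) (simp add: M0_def)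
    ultimately show False using ef(2) by (auto simp: M0_def)
  qed
  define D where "D = Max (insert 0 (mdeg ` M0))"
  have step: "\<exists>i. \<exists>f\<in>M. e = Poly_Mapping.single i 1 + f" if "e \<in> M" "mdeg e > D" for e
  proof (rule ccontr)
    assume "\<not> ?thesis"
    then have "e \<in> M0" using that by (simp add: M0_def)
    then have "mdeg e \<le> D" unfolding D_def using \<open>finite M0\<close> by (intro Max_ge) auto
    then show False using that by simp
  qed
  show thesis
  proof (rule that[of D])
    fix d assume d: "d \<ge> D"
    let ?G = "{x * q | x q. x \<in> homogeneous_part 1 \<and> q \<in> X \<inter> homogeneous_part d}"
    \<comment> \<open>The monomials that may still occur: a finite set that shrinks at each cancellation, so that its
      cardinality serves as the measure of the induction.\<close>
    define below where "below p = {f :: 'n \<Rightarrow>\<^sub>0 nat. mdeg f = Suc d \<and> (\<exists>g\<in>Poly_Mapping.keys p. monomial_rank f \<le> monomial_rank g)}"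
      for p :: "('n, 'k) mpoly"
    have fin: "finite (below p)" for p
      by (rule finite_subset[OF _ finite_mdeg[of "Suc d"]]) (auto simp: below_def)
    have "p \<in> P.span ?G" if "p \<in> X" "p \<in> homogeneous_part (Suc d)" for p
      using that
    proof (induction "card (below p)" arbitrary: p rule: less_induct)
      case less
      show ?case
      proof (cases "p = 0")
        case True then show ?thesis by (simp add: P.span_zero)
      next
        case False
        then obtain e where e: "is_leading p e" by (rule ex_leading)
        then have de: "mdeg e = Suc d" using less.prems by (auto simp: is_leading_def homogeneous_part_def)
        then have "e \<in> M" using e less.prems by (auto simp: M_def)
        then obtain i f where f: "f \<in> M" "e = Poly_Mapping.single i 1 + f" using step de d by force
        have "mdeg e = 1 + mdeg f" unfolding f(2) mdeg_add mdeg_single ..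
        then have df: "mdeg f = d" using de by simp
        obtain q where q: "q \<in> X" "q \<in> homogeneous_part d" "is_leading q f"
          using f(1) df by (auto simp: M_def)
        let ?q = "var_poly i * q"
        have lq: "is_leading ?q e" using is_leading_var_mult[OF q(3)] f(2) by simp
        have qG: "?q \<in> ?G" using q var_poly_in by blast
        have qX: "?q \<in> X" using q X by (simp add: ideal.subspace_scale)
        have qd: "?q \<in> homogeneous_part (Suc d)" using homogeneous_part_mult[OF var_poly_in q(2)] by simp
        define c where "c = Poly_Mapping.lookup p e / Poly_Mapping.lookup ?q e"
        define p' where "p' = p - poly_scale c ?q"
        have p'X: "p' \<in> X" unfolding p'_def poly_scale_conv
          using less.prems qX X by (simp add: ideal.subspace_diff ideal.subspace_scale)
        have p'd: "p' \<in> homogeneous_part (Suc d)"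
          unfolding p'_def using less.prems qd
          by (intro P.subspace_diff P.subspace_scale subspace_homogeneous_part)
        have "Poly_Mapping.lookup p' e = 0"
          using lq by (simp add: p'_def lookup_minus lookup_poly_scale c_def is_leading_def in_keys_iff)
        then have lt: "monomial_rank g < monomial_rank e" if "g \<in> Poly_Mapping.keys p'" for g
        proof -
          have "g \<noteq> e" using that \<open>Poly_Mapping.lookup p' e = 0\<close> by (auto simp: in_keys_iff)
          moreover have "g \<in> Poly_Mapping.keys p \<or> g \<in> Poly_Mapping.keys ?q"
            using that by (auto simp: p'_def in_keys_iff lookup_minus lookup_poly_scale)
          then have "monomial_rank g \<le> monomial_rank e" using e lq by (auto simp: is_leading_def)
          ultimately show ?thesis using monomial_rank(1) by (metis inj_eq le_neq_trans)
        qed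
        have "below p' \<subseteq> below p"
        proof
          fix f assume "f \<in> below p'"
          then obtain g where g: "mdeg f = Suc d" "g \<in> Poly_Mapping.keys p'" "monomial_rank f \<le> monomial_rank g"
            by (auto simp: below_def)
          then have "monomial_rank f \<le> monomial_rank e" using lt[of g] by simp
          then show "f \<in> below p" using g(1) e by (auto simp: below_def is_leading_def)
        qed
        moreover have "e \<in> below p" using e de by (auto simp: below_def is_leading_def)
        moreover have "e \<notin> below p'" using lt by (auto simp: below_def not_le)
        ultimately have "card (below p') < card (below p)"
          using fin by (intro psubset_card_mono) auto
        then have "p' \<in> P.span ?G" using p'X p'd by (rule less.hyps)
        then have "p' + poly_scale c ?q \<in> P.span ?G"
          using qG by (intro P.span_add P.span_scale) (auto intro: P.span_base)
        then show ?thesis by (simp add: p'_def)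
      qed
    qed
    then show "X \<inter> homogeneous_part (Suc d) \<subseteq> P.span ?G" by blast
  qed
qed

text \<open>
  By generation in bounded degree, every form of large degree in \<open>X\<close> is a combination of products of
  a form of degree \<open>N\<close> with an element of \<open>X\<close>.
\<close>

lemma eventually_contained:
  fixes X Y :: "('n::finite, 'k::field) mpoly set"
  assumes X: "ideal.subspace X" and Y: "ideal.subspace Y"
    and N: "\<And>u p. u \<in> homogeneous_part N \<Longrightarrow> p \<in> X \<Longrightarrow> u * p \<in> Y"
  shows "\<exists>D. \<forall>d\<ge>D. X \<inter> homogeneous_part d \<subseteq> Y"
proof -
  obtain D where D: "\<And>d. d \<ge> D \<Longrightarrow> X \<inter> homogeneous_part (Suc d) \<subseteq>
    P.span {x * q | x q. x \<in> homogeneous_part 1 \<and> q \<in> X \<inter> homogeneous_part d}"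
    using generated_in_bounded_degree[OF X] by blast
  have "X \<inter> homogeneous_part (k + d) \<subseteq> P.span {u * q | u q. u \<in> homogeneous_part k \<and> q \<in> X}"
    if "d \<ge> D" for k d
  proof (induction k)
    case 0
    have "(1 :: ('n, 'k) mpoly) \<in> homogeneous_part 0" by (simp add: homogeneous_part_def)
    then have "p = 1 * p \<and> (1 :: ('n, 'k) mpoly) \<in> homogeneous_part 0" for p :: "('n, 'k) mpoly" by simp
    then show ?case by (blast intro: P.span_base)
  next
    case (Suc k)
    let ?G = "{u * q | u q. u \<in> homogeneous_part (Suc k) \<and> q \<in> X}"
    have "x * q \<in> P.span ?G" if x: "x \<in> homogeneous_part 1" and q: "q \<in> X \<inter> homogeneous_part (k + d)" for x q
    proof -
      have "q \<in> P.span {u * q | u q. u \<in> homogeneous_part k \<and> q \<in> X}" using Suc q by blast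
      then show ?thesis
      proof (induction rule: P.span_induct_alt)
        case base then show ?case by (simp add: P.span_zero)
      next
        case (step c g y)
        then obtain u r where g: "g = u * r" "u \<in> homogeneous_part k" "r \<in> X" by blast
        have "x * u \<in> homogeneous_part (Suc k)" using homogeneous_part_mult[OF x g(2)] by simp
        then have "(x * u) * r \<in> P.span ?G" using g(3) by (intro P.span_base) blast
        then have "poly_scale c ((x * u) * r) + x * y \<in> P.span ?G"
          using step by (intro P.span_add P.span_scale)
        moreover have "poly_scale c ((x * u) * r) + x * y = x * (poly_scale c g + y)"
          unfolding g(1) poly_scale_conv by (simp add: algebra_simps)
        ultimately show ?case by simp
      qed
    qed
    then have "P.span {x * q | x q. x \<in> homogeneous_part 1 \<and> q \<in> X \<inter> homogeneous_part (k + d)} \<subseteq> P.span ?G"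
      by (intro P.span_minimal) auto
    then show ?case using D[of "k + d"] that by auto
  qed
  moreover have "P.span {u * q | u q. u \<in> homogeneous_part N \<and> q \<in> X} \<subseteq> Y"
    using N Y by (intro P.span_minimal ideal_subspace_imp_subspace) auto
  ultimately have "X \<inter> homogeneous_part (N + d) \<subseteq> Y" if "d \<ge> D" for d
    using that by (meson subset_trans)
  then have "X \<inter> homogeneous_part d \<subseteq> Y" if "d \<ge> D + N" for d
    using that[THEN add_le_imp_le_diff] by (metis add.commute add_leD2 le_add_diff_inverse that)
  then show ?thesis by blast
qed

section \<open>Products and intersections of linear ideals\<close>

definition form_products :: "'i set \<Rightarrow> ('i \<Rightarrow> 'r::comm_ring_1 set) \<Rightarrow> 'r set" where
  "form_products A L = {\<Prod>i\<in>A. f i |f. \<forall>i\<in>A. f i \<in> L i}"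

lemma form_products_empty [simp]: "form_products {} L = {1}"
  by (auto simp: form_products_def)

lemma form_products_insert:
  assumes "finite A" "i \<notin> A"
  shows "form_products (insert i A) L = {x * y | x y. x \<in> L i \<and> y \<in> form_products A L}"
proof (intro subset_antisym subsetI)
  fix p assume "p \<in> form_products (insert i A) L"
  then obtain f where f: "p = (\<Prod>j\<in>insert i A. f j)" "\<forall>j\<in>insert i A. f j \<in> L j"
    by (auto simp: form_products_def)
  then have "p = f i * (\<Prod>j\<in>A. f j)" using assms by simp
  then show "p \<in> {x * y | x y. x \<in> L i \<and> y \<in> form_products A L}"
    using f(2) by (auto simp: form_products_def)
next
  fix p assume "p \<in> {x * y | x y. x \<in> L i \<and> y \<in> form_products A L}"
  then obtain x f where p: "p = x * (\<Prod>j\<in>A. f j)" "x \<in> L i" "\<forall>j\<in>A. f j \<in> L j"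
    by (auto simp: form_products_def)
  have "(\<Prod>j\<in>A. (f(i := x)) j) = (\<Prod>j\<in>A. f j)"
    using assms by (intro prod.cong) auto
  then have "p = (\<Prod>j\<in>insert i A. (f(i := x)) j)" "\<forall>j\<in>insert i A. (f(i := x)) j \<in> L j"
    using p assms by auto
  then show "p \<in> form_products (insert i A) L" unfolding form_products_def by blast
qed

lemma ideal_gen_mult_mono:
  assumes "x \<in> ideal_gen G" "\<And>g. g \<in> G \<Longrightarrow> g * q \<in> ideal_gen H"
  shows "x * q \<in> ideal_gen H"
  using assms(1) unfolding ideal_gen_eq_span
proof (induction rule: ideal.span_induct_alt)
  case base then show ?case by (simp add: ideal.span_zero)
next
  case (step c g y)
  have "c * (g * q) + y * q \<in> ideal.span H"
    using assms(2)[OF step(1)] step(2) unfolding ideal_gen_eq_span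
    by (rule ideal.span_add[OF ideal.span_scale])
  then show ?case by (simp add: distrib_right mult.assoc)
qed

text \<open>Makes the product ideal visibly homogeneous: products of linear forms generate it.\<close>

lemma ideal_product_ideal_gen:
  assumes "finite A"
  shows "ideal_product A (\<lambda>i. ideal_gen (L i)) = ideal_gen (form_products A L)"
proof -
  have "(\<Prod>i\<in>A. f i) \<in> ideal_gen (form_products A L)" if "\<forall>i\<in>A. f i \<in> ideal_gen (L i)" for f
    using assms that
  proof (induction A)
    case empty then show ?case by (simp add: ideal_gen_eq_span ideal.span_base)
  next
    case (insert i A)
    have "y * f i \<in> ideal_gen (form_products (insert i A) L)" if y: "y \<in> form_products A L" for y
    proof -
      have "f i * y \<in> ideal_gen (form_products (insert i A) L)"
        using insert(1,2) insert.prems y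
        by (intro ideal_gen_mult_mono[of "f i" "L i"])
          (auto simp: form_products_insert ideal_gen_eq_span intro!: ideal.span_base)
      then show ?thesis by (simp add: mult.commute)
    qed
    moreover have "(\<Prod>i\<in>A. f i) \<in> ideal_gen (form_products A L)"
      using insert by simp
    ultimately have "(\<Prod>i\<in>A. f i) * f i \<in> ideal_gen (form_products (insert i A) L)"
      by (rule ideal_gen_mult_mono[rotated])
    then show ?case using insert by (simp add: mult.commute)
  qed
  then have "ideal_product A (\<lambda>i. ideal_gen (L i)) \<subseteq> ideal_gen (form_products A L)"
    unfolding ideal_product_def ideal_gen_eq_span by (intro ideal.span_minimal) auto
  moreover have "form_products A L \<subseteq> {\<Prod>i\<in>A. f i |f. \<forall>i\<in>A. f i \<in> ideal_gen (L i)}"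
    unfolding form_products_def ideal_gen_eq_span using ideal.span_base by blast
  then have "ideal_gen (form_products A L) \<subseteq> ideal_product A (\<lambda>i. ideal_gen (L i))"
    unfolding ideal_product_def ideal_gen_eq_span by (rule ideal.span_mono)
  ultimately show ?thesis by blast
qed

text \<open>
  The preimage in the ring of the product ideal \<open>\<Prod>\<^sub>i (L i)\<close> of the quotient by \<open>(L0)\<close>. Working with
  preimages replaces a change of the polynomial ring by a change of \<open>L0\<close>.
\<close>

definition product_ideal_mod ::
    "'i set \<Rightarrow> ('i \<Rightarrow> 'r::comm_ring_1 set) \<Rightarrow> 'r set \<Rightarrow> 'r set" where
  "product_ideal_mod A L L0 = ideal_gen (form_products A L \<union> L0)"

lemma product_ideal_mod_step:
  assumes "finite A" "i \<notin> A" "x \<in> L i" "p \<in> product_ideal_mod A L L0"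
  shows "x * p \<in> product_ideal_mod (insert i A) L L0"
proof -
  have "p * x \<in> product_ideal_mod (insert i A) L L0"
    unfolding product_ideal_mod_def
  proof (rule ideal_gen_mult_mono)
    show "p \<in> ideal_gen (form_products A L \<union> L0)"
      using assms(4) by (simp add: product_ideal_mod_def)
    fix g assume "g \<in> form_products A L \<union> L0"
    then consider "g \<in> form_products A L" | "g \<in> L0" by blast
    then show "g * x \<in> ideal_gen (form_products (insert i A) L \<union> L0)"
    proof cases
      case 1
      then have "x * g \<in> form_products (insert i A) L"
        using assms by (auto simp: form_products_insert)
      then show ?thesis by (simp add: ideal_gen_eq_span ideal.span_base mult.commute)
    next
      case 2
      then have "x * g \<in> ideal.span (form_products (insert i A) L \<union> L0)"
        by (intro ideal.span_scale ideal.span_base) auto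
      then show ?thesis by (simp add: ideal_gen_eq_span mult.commute)
    qed
  qed
  then show ?thesis by (simp add: mult.commute)
qed

lemma product_ideal_mod_insert_subset:
  assumes "finite A" "i \<notin> A"
  shows "product_ideal_mod (insert i A) L L0 \<subseteq> product_ideal_mod A L L0"
    and "product_ideal_mod (insert i A) L L0 \<subseteq> ideal_gen (L i \<union> L0)"
proof -
  have *: "x * y \<in> ideal.span (form_products A L \<union> L0)" "x * y \<in> ideal.span (L i \<union> L0)"
    if "x \<in> L i" "y \<in> form_products A L" for x y
    using that ideal.span_scale[of y "form_products A L \<union> L0" x]
      ideal.span_scale[of x "L i \<union> L0" y] by (auto simp: ideal.span_base mult.commute)
  show "product_ideal_mod (insert i A) L L0 \<subseteq> product_ideal_mod A L L0"
    unfolding product_ideal_mod_def ideal_gen_eq_span form_products_insert[OF assms]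
    using * by (intro ideal.span_minimal) (auto intro: ideal.span_base)
  show "product_ideal_mod (insert i A) L L0 \<subseteq> ideal_gen (L i \<union> L0)"
    unfolding product_ideal_mod_def ideal_gen_eq_span form_products_insert[OF assms]
    using * by (intro ideal.span_minimal) (auto intro: ideal.span_base)
qed

lemma product_ideal_mod_subset:
  assumes "finite A" "i \<in> A"
  shows "product_ideal_mod A L L0 \<subseteq> ideal_gen (L i \<union> L0)"
  using product_ideal_mod_insert_subset(2)[of "A - {i}" i L L0] assms by (simp add: insert_absorb)

lemma product_ideal_mod_empty: "product_ideal_mod {} L L0 = UNIV"
proof -
  have "c * 1 \<in> ideal.span (insert 1 L0)" for c
    by (intro ideal.span_scale ideal.span_base) auto
  then show ?thesis by (auto simp: product_ideal_mod_def ideal_gen_eq_span)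
qed

lemma subspace_ideal_gen: "ideal.subspace (ideal_gen G)"
  by (simp add: ideal_gen_eq_span)

lemma P_span_subset_ideal_gen: "P.span G \<subseteq> ideal_gen G"
  by (intro P.span_minimal ideal_subspace_imp_subspace subspace_ideal_gen)
    (auto simp: ideal_gen_eq_span ideal.span_base)

text \<open>
  Choose coordinates \<open>E\<close> containing bases \<open>C\<close> and \<open>D\<close> of the two spans in \<open>meet\<close>, and let \<open>h\<close> set
  the variables in \<open>D - C\<close> to zero. The generators of the product ideal for \<open>A\<close> are fixed by \<open>h\<close>, so
  \<open>p - h p\<close> is a combination of them with coefficients of the form \<open>r - h r \<in> (L m) + (L0)\<close> and lies in
  the product ideal for \<open>insert m A\<close>. By the assumption \<open>meet\<close>, \<open>h\<close> maps \<open>L m\<close> into the span of \<open>L0\<close>,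
  so \<open>h p \<in> (L0)\<close>.
\<close>

lemma product_ideal_mod_Int:
  fixes L :: "'i \<Rightarrow> ('n::finite, 'k::field) mpoly set"
  assumes A: "finite A" "m \<notin> A"
    and L: "\<And>i. i \<in> A \<Longrightarrow> L i \<subseteq> homogeneous_part 1" "L m \<subseteq> homogeneous_part 1" "L0 \<subseteq> homogeneous_part 1"
    and meet: "P.span (L0 \<union> (\<Union>i\<in>A. L i)) \<inter> P.span (L0 \<union> L m) = P.span L0"
    and p: "p \<in> product_ideal_mod A L L0" "p \<in> ideal_gen (L m \<union> L0)"
  shows "p \<in> product_ideal_mod (insert m A) L L0"
proof -
  obtain C D where CD: "P.independent (C \<union> D)" "P.span C = P.span (L0 \<union> (\<Union>i\<in>A. L i))"
    "P.span D = P.span (L0 \<union> L m)" "P.span (C \<inter> D) = P.span L0"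
    using P.adapted_bases[of "P.span (L0 \<union> (\<Union>i\<in>A. L i))" "P.span (L0 \<union> L m)"] meet by auto
  have "P.span C \<subseteq> homogeneous_part 1" "P.span D \<subseteq> homogeneous_part 1"
    unfolding CD using L by (intro P.span_minimal subspace_homogeneous_part; auto)+
  then have CDsub: "C \<union> D \<subseteq> homogeneous_part 1"
    using P.span_superset[of C] P.span_superset[of D] by blast
  obtain E where E: "C \<union> D \<subseteq> E" "E \<subseteq> homogeneous_part 1" "P.independent E" "homogeneous_part 1 \<subseteq> P.span E"
    using P.maximal_independent_subset_extend[OF CDsub CD(1)] by blast
  have DC: "D - C \<subseteq> E" using E by blast
  obtain h where endo: "ring_endomorphism h" and h': "\<forall>v\<in>P.span (E - (D - C)). h v = v"
    "\<forall>v\<in>D - C. h v = 0" "\<forall>p. p - h p \<in> ideal_gen (D - C)"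
    using coordinate_projection[OF E(3,2,4) DC] by blast
  have h: "\<And>p q. h (p + q) = h p + h q" "\<And>p q. h (p * q) = h p * h q" "h 1 = 1"
    "\<And>v. v \<in> P.span (E - (D - C)) \<Longrightarrow> h v = v" "\<And>v. v \<in> D - C \<Longrightarrow> h v = 0"
    "\<And>p. p - h p \<in> ideal_gen (D - C)"
    using endo h' unfolding ring_endomorphism_def by blast+
  have h0: "h 0 = 0" using h(1)[of 0 0] by simp
  have fix_C: "h v = v" if "v \<in> L0 \<union> (\<Union>i\<in>A. L i)" for v
  proof -
    have "v \<in> P.span C" unfolding CD(2) using that by (rule P.span_base)
    moreover have "P.span C \<subseteq> P.span (E - (D - C))" using E(1) by (intro P.span_mono) blast
    ultimately show ?thesis using h(4) by blast
  qed
  have hprod: "h (\<Prod>i\<in>B. f i) = (\<Prod>i\<in>B. h (f i))" for B :: "'i set" and f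
    by (induction B rule: infinite_finite_induct) (simp_all add: h)
  have fix_products: "h g = g" if g: "g \<in> form_products A L" for g
  proof -
    obtain f where f: "g = (\<Prod>i\<in>A. f i)" "\<forall>i\<in>A. f i \<in> L i"
      using g by (auto simp: form_products_def)
    then have "h (f i) = f i" if "i \<in> A" for i using fix_C[of "f i"] that by auto
    then show ?thesis by (simp add: f(1) hprod)
  qed
  let ?Q = "ideal.span (form_products (insert m A) L \<union> L0)"
  have D_sub: "ideal_gen (D - C) \<subseteq> ideal_gen (L m \<union> L0)"
  proof -
    have "D - C \<subseteq> P.span (L m \<union> L0)" using CD(3) P.span_superset[of D] by (auto simp: Un_commute)
    then have "D - C \<subseteq> ideal_gen (L m \<union> L0)" using P_span_subset_ideal_gen by blast
    then show ?thesis
      unfolding ideal_gen_eq_span by (intro ideal.span_minimal) auto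
  qed
  have times_product: "r * g \<in> ?Q" if "r \<in> ideal_gen (L m \<union> L0)" "g \<in> form_products A L" for r g
    unfolding ideal_gen_eq_span[symmetric]
  proof (rule ideal_gen_mult_mono[OF that(1)])
    fix x assume "x \<in> L m \<union> L0"
    then show "x * g \<in> ideal_gen (form_products (insert m A) L \<union> L0)"
    proof
      assume "x \<in> L m"
      then have "x * g \<in> form_products (insert m A) L"
        using that(2) A by (auto simp: form_products_insert)
      then show ?thesis by (simp add: ideal_gen_eq_span ideal.span_base)
    next
      assume "x \<in> L0"
      then have "g * x \<in> ?Q" by (simp add: ideal.span_scale ideal.span_base)
      then show ?thesis by (simp add: ideal_gen_eq_span mult.commute)
    qed
  qed
  have "p - h p \<in> ?Q"
    using p(1) unfolding product_ideal_mod_def ideal_gen_eq_span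
  proof (induction rule: ideal.span_induct_alt)
    case base then show ?case by (simp add: h0 ideal.span_zero)
  next
    case (step c g y)
    have hg: "h g = g" using step(1) fix_products fix_C by blast
    have "(c - h c) * g \<in> ?Q"
    proof (cases "g \<in> form_products A L")
      case True then show ?thesis using times_product h(6)[of c] D_sub by blast
    next
      case False then show ?thesis using step(1) by (intro ideal.span_scale ideal.span_base) auto
    qed
    then have "(c - h c) * g + (y - h y) \<in> ?Q" using step(2) by (rule ideal.span_add)
    then show ?case by (simp add: h hg algebra_simps)
  qed
  moreover have "h p \<in> ?Q"
  proof -
    have hL: "h v \<in> ideal_gen L0" if "v \<in> L m \<union> L0" for v
    proof -
      have "v \<in> P.span D" unfolding CD(3) using that by (intro P.span_base) auto
      then show ?thesis
      proof (induction rule: P.span_induct_alt)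
        case base then show ?case by (simp add: h0 ideal_gen_eq_span ideal.span_zero)
      next
        case (step c x y)
        have hx: "h x \<in> ideal_gen L0"
        proof (cases "x \<in> C")
          case True
          then have "h x = x" using E(1) by (intro h(4) P.span_base) auto
          moreover have "x \<in> P.span L0" unfolding CD(4)[symmetric] using step(1) True by (intro P.span_base) auto
          ultimately show ?thesis using P_span_subset_ideal_gen by auto
        next
          case False then show ?thesis using h(5)[of x] step(1) by (simp add: ideal_gen_eq_span ideal.span_zero)
        qed
        then show ?case using step(2)
          by (simp add: h poly_scale_conv ideal_gen_eq_span ideal.span_add ideal.span_scale)
      qed
    qed
    have "h p \<in> ideal_gen L0"
      using p(2) unfolding ideal_gen_eq_span
    proof (induction rule: ideal.span_induct_alt)
      case base then show ?case by (simp add: h0 ideal.span_zero)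
    next
      case (step c x y)
      then show ?case using hL[OF step(1)] by (simp add: h ideal_gen_eq_span ideal.span_add ideal.span_scale)
    qed
    then show ?thesis unfolding ideal_gen_eq_span using ideal.span_mono[of L0] by blast
  qed
  ultimately have "(p - h p) + h p \<in> ?Q" by (rule ideal.span_add)
  then show ?thesis by (simp add: product_ideal_mod_def ideal_gen_eq_span)
qed

text \<open>
  Transversality for sets of linear forms, relative to \<open>L0\<close>. The numbers \<open>c i\<close> and \<open>c0\<close> are prescribed
  data rather than the dimensions of \<open>L i\<close> and \<open>L0\<close>. This makes the condition stable: if it holds for
  \<open>insert m A\<close> and \<open>L0\<close>, it holds for \<open>A\<close> and \<open>L m \<union> L0\<close> with \<open>c0 + c m\<close>, even when that sum exceeds
  the dimension of \<open>V\<close>.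
\<close>

definition transversal_forms ::
    "'i set \<Rightarrow> ('i \<Rightarrow> ('n::finite, 'k::field) mpoly set) \<Rightarrow> ('n, 'k) mpoly set \<Rightarrow> ('i \<Rightarrow> nat) \<Rightarrow> nat \<Rightarrow> bool" where
  "transversal_forms A L L0 c c0 \<longleftrightarrow>
     L0 \<subseteq> homogeneous_part 1 \<and> (\<forall>i\<in>A. L i \<subseteq> homogeneous_part 1) \<and>
     (\<forall>S\<subseteq>A. P.dim (L0 \<union> (\<Union>i\<in>S. L i)) = min CARD('n) (c0 + sum c S))"

lemma transversal_forms_subset:
  "transversal_forms A L L0 c c0 \<Longrightarrow> B \<subseteq> A \<Longrightarrow> transversal_forms B L L0 c c0"
  by (auto simp: transversal_forms_def)

text \<open>
  As long as the codimensions add up to at most the dimension of \<open>V\<close>, dimension counting shows that the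
  span of \<open>L m\<close> and \<open>L0\<close> meets the span of the other forms in the span of \<open>L0\<close> only, so the ideals can
  be multiplied in one at a time.
\<close>

lemma independent_INT_subset_product:
  fixes L :: "'i \<Rightarrow> ('n::finite, 'k::field) mpoly set"
  assumes "finite A" "transversal_forms A L L0 c c0" "c0 + sum c A \<le> CARD('n)"
    and "\<And>i. i \<in> A \<Longrightarrow> p \<in> ideal_gen (L i \<union> L0)"
  shows "p \<in> product_ideal_mod A L L0"
  using assms
proof (induction A)
  case empty then show ?case by (simp add: product_ideal_mod_empty)
next
  case (insert m A)
  have T: "transversal_forms A L L0 c c0"
    using insert.prems(1) by (rule transversal_forms_subset) auto
  have pA: "p \<in> product_ideal_mod A L L0"
    using insert T by auto
  have L: "L0 \<subseteq> homogeneous_part 1" "\<forall>i\<in>insert m A. L i \<subseteq> homogeneous_part 1"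
    and dims: "\<And>S. S \<subseteq> insert m A \<Longrightarrow> P.dim (L0 \<union> (\<Union>i\<in>S. L i)) = min CARD('n) (c0 + sum c S)"
    using insert.prems(1) by (auto simp: transversal_forms_def)
  let ?X = "L0 \<union> (\<Union>i\<in>A. L i)" and ?Y = "L0 \<union> L m"
  have XY: "?X \<subseteq> homogeneous_part 1" "?Y \<subseteq> homogeneous_part 1" using L by auto
  have "?X \<union> ?Y = L0 \<union> (\<Union>i\<in>insert m A. L i)" by auto
  then have dXY: "P.dim (?X \<union> ?Y) = c0 + c m + sum c A"
    using dims[of "insert m A"] insert by simp
  have dX: "P.dim ?X = c0 + sum c A" using dims[of A] insert by auto
  have dY: "P.dim ?Y = c0 + c m" using dims[of "{m}"] insert by auto
  have d0: "P.dim L0 = c0" using dims[of "{}"] insert by auto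
  have "P.dim (?X \<union> ?Y) + P.dim (P.span ?X \<inter> P.span ?Y) = P.dim ?X + P.dim ?Y"
    using XY by (intro P.dim_Un_plus_dim_Int[OF finite_monomials[of 1]])
      (simp_all add: homogeneous_part_eq_span)
  then have dI: "P.dim (P.span ?X \<inter> P.span ?Y) = c0" using dXY dX dY by simp
  have "P.span L0 = P.span (P.span ?X \<inter> P.span ?Y)"
  proof (rule P.dim_equal_imp_span_eq[OF _ _ finite_monomials[of 1]])
    show "L0 \<subseteq> P.span ?X \<inter> P.span ?Y" by (auto intro: P.span_base)
    have "P.span ?X \<subseteq> homogeneous_part 1"
      using XY by (intro P.span_minimal subspace_homogeneous_part)
    then show "P.span ?X \<inter> P.span ?Y \<subseteq> P.span (monomials 1)"
      by (auto simp: homogeneous_part_eq_span)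
    show "P.dim L0 = P.dim (P.span ?X \<inter> P.span ?Y)" using d0 dI by simp
  qed
  then have meet: "P.span ?X \<inter> P.span ?Y = P.span L0"
    by (simp add: P.subspace_inter P.span_eq_iff[THEN iffD2])
  show ?case
    using insert L pA meet by (intro product_ideal_mod_Int) auto
qed

text \<open>
  Induction on the number of ideals. When the codimensions add up to at most the dimension of \<open>V\<close>, \<open>p\<close>
  itself lies in the product ideal. When they add up to more, every linear form is a combination of elements \<open>t\<close> of the \<open>L i\<close> and of \<open>L0\<close>, so it is enough to multiply by
  products \<open>t w\<close> with \<open>w\<close> of degree one less; the induction hypothesis without the index \<open>i\<close> puts \<open>w p\<close>
  into the remaining product, and \<open>t\<close> supplies the factor from \<open>L i\<close>.
\<close>

lemma homogeneous_part_mult_INT_subset_product: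
  fixes L :: "'i \<Rightarrow> ('n::finite, 'k::field) mpoly set"
  assumes "finite A" "transversal_forms A L L0 c c0"
    and "u \<in> homogeneous_part (card A)" "\<And>i. i \<in> A \<Longrightarrow> p \<in> ideal_gen (L i \<union> L0)"
  shows "u * p \<in> product_ideal_mod A L L0"
  using assms
proof (induction "card A" arbitrary: A u)
  case 0
  then show ?case by (simp add: product_ideal_mod_empty)
next
  case (Suc k)
  have Q: "ideal.subspace (product_ideal_mod A L L0)"
    by (simp add: product_ideal_mod_def subspace_ideal_gen)
  show ?case
  proof (cases "c0 + sum c A \<le> CARD('n)")
    case True
    then have "p \<in> product_ideal_mod A L L0"
      using Suc.prems by (intro independent_INT_subset_product) auto
    then show ?thesis using Q by (simp add: ideal.subspace_scale)
  next
    case False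
    let ?T = "L0 \<union> (\<Union>i\<in>A. L i)"
    have "P.dim ?T = CARD('n)" and T1: "?T \<subseteq> homogeneous_part 1"
      using Suc.prems(2) False by (auto simp: transversal_forms_def)
    then have "P.span ?T = P.span (homogeneous_part 1)"
      by (intro P.dim_equal_imp_span_eq[OF _ _ finite_monomials[of 1]])
        (simp_all add: homogeneous_part_eq_span[symmetric] dim_homogeneous_part_1[simplified])
    then have span_T: "homogeneous_part 1 \<subseteq> P.span ?T" using P.span_superset by blast
    have "x * w * p \<in> product_ideal_mod A L L0"
      if x: "x \<in> homogeneous_part 1" and w: "w \<in> homogeneous_part k" for x w
    proof -
      have "t * (w * p) \<in> product_ideal_mod A L L0" if t: "t \<in> ?T" for t
      proof (cases "t \<in> L0")
        case True
        then have "(w * p) * t \<in> product_ideal_mod A L L0"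
          unfolding product_ideal_mod_def ideal_gen_eq_span by (intro ideal.span_scale ideal.span_base) auto
        then show ?thesis by (simp add: mult.commute)
      next
        case False
        then obtain i where i: "i \<in> A" "t \<in> L i" using t by blast
        have "w * p \<in> product_ideal_mod (A - {i}) L L0"
        proof (rule Suc.hyps)
          show k: "k = card (A - {i})" using Suc.hyps(2) i Suc.prems(1) by simp
          show "transversal_forms (A - {i}) L L0 c c0"
            using Suc.prems(2) by (rule transversal_forms_subset) auto
          show "w \<in> homogeneous_part (card (A - {i}))" using w unfolding k .
        qed (use Suc.prems in auto)
        then have "t * (w * p) \<in> product_ideal_mod (insert i (A - {i})) L L0"
          using Suc.prems(1) i by (intro product_ideal_mod_step) auto
        then show ?thesis using i by (simp add: insert_absorb)
      qed
      moreover have "P.subspace {t. t * (w * p) \<in> product_ideal_mod A L L0}"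
        using Q by (intro P.subspaceI)
          (auto simp: distrib_right poly_scale_conv mult.assoc ideal.subspace_0 ideal.subspace_add ideal.subspace_scale)
      ultimately have "P.span ?T \<subseteq> {t. t * (w * p) \<in> product_ideal_mod A L L0}"
        by (intro P.span_minimal) blast+
      then show ?thesis using x span_T by (auto simp: mult.assoc)
    qed
    moreover have "P.subspace {u. u * p \<in> product_ideal_mod A L L0}"
      using Q by (intro P.subspaceI)
        (auto simp: distrib_right poly_scale_conv mult.assoc ideal.subspace_0 ideal.subspace_add ideal.subspace_scale)
    ultimately have "P.span {x * w | x w. x \<in> homogeneous_part 1 \<and> w \<in> homogeneous_part k} \<subseteq>
        {u. u * p \<in> product_ideal_mod A L L0}"
      by (intro P.span_minimal) blast+
    moreover have "u \<in> homogeneous_part (Suc k)" using Suc.prems(3) Suc.hyps(2) by simp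
    ultimately show ?thesis unfolding homogeneous_part_Suc by blast
  qed
qed

lemma product_eventually_eq_INT:
  fixes L :: "'i \<Rightarrow> ('n::finite, 'k::field) mpoly set"
  assumes A: "finite A" and T: "transversal_forms A L L0 c c0"
  shows "\<exists>D. \<forall>d\<ge>D. product_ideal_mod A L L0 \<inter> homogeneous_part d =
    (\<Inter>i\<in>A. ideal_gen (L i \<union> L0)) \<inter> homogeneous_part d"
proof -
  have "\<exists>D. \<forall>d\<ge>D. (\<Inter>i\<in>A. ideal_gen (L i \<union> L0)) \<inter> homogeneous_part d \<subseteq> product_ideal_mod A L L0"
  proof (rule eventually_contained)
    show "ideal.subspace (\<Inter>i\<in>A. ideal_gen (L i \<union> L0))" by (intro ideal.subspace_Int subspace_ideal_gen)
    show "ideal.subspace (product_ideal_mod A L L0)"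
      by (simp add: product_ideal_mod_def subspace_ideal_gen)
    show "u * p \<in> product_ideal_mod A L L0"
      if "u \<in> homogeneous_part (card A)" "p \<in> (\<Inter>i\<in>A. ideal_gen (L i \<union> L0))" for u p
      using homogeneous_part_mult_INT_subset_product[OF A T that(1)] that(2) by blast
  qed
  moreover have "product_ideal_mod A L L0 \<subseteq> (\<Inter>i\<in>A. ideal_gen (L i \<union> L0))"
    using product_ideal_mod_subset[OF A] by blast
  ultimately show ?thesis by blast
qed

section \<open>Hilbert series of ideals of linear forms\<close>

lemma hilbert_series_nth: "fps_nth (hilbert_series M) d = of_nat (P.dim (M \<inter> homogeneous_part d))"
  by (simp add: hilbert_series_def)

lemma homogeneous_ideal_subspace: "homogeneous_ideal X \<Longrightarrow> ideal.subspace X"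
  by (simp add: homogeneous_ideal_def)

lemma P_dim_0 [simp]: "P.dim {0} = 0"
  using P.dim_span_eq_card_independent[OF P.independent_empty] by simp

text \<open>The modular law in each degree.\<close>

lemma hilbert_series_Int_plus_sum:
  assumes "homogeneous_ideal X" "homogeneous_ideal Y"
  shows "hilbert_series (X \<inter> Y) + hilbert_series (ideal_gen (X \<union> Y)) = hilbert_series X + hilbert_series Y"
proof (rule fps_ext)
  fix d
  let ?X = "X \<inter> homogeneous_part d" and ?Y = "Y \<inter> homogeneous_part d"
  have spans: "P.span ?X = ?X" "P.span ?Y = ?Y"
    using assms by (simp_all add: homogeneous_ideal_subspace ideal_subspace_imp_subspace P.subspace_inter subspace_homogeneous_part)
  have "P.span ?X \<inter> P.span ?Y = X \<inter> Y \<inter> homogeneous_part d" unfolding spans by blast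
  moreover have "P.dim (?X \<union> ?Y) = P.dim (ideal_gen (X \<union> Y) \<inter> homogeneous_part d)"
    using span_Un_homogeneous[OF assms, of d] P.dim_span by metis
  moreover have "P.dim (?X \<union> ?Y) + P.dim (P.span ?X \<inter> P.span ?Y) = P.dim ?X + P.dim ?Y"
    by (rule P.dim_Un_plus_dim_Int[OF finite_monomials[of d]]) (auto simp: homogeneous_part_eq_span)
  ultimately have "P.dim (X \<inter> Y \<inter> homogeneous_part d) + P.dim (ideal_gen (X \<union> Y) \<inter> homogeneous_part d) =
      P.dim ?X + P.dim ?Y" by simp
  then show "fps_nth (hilbert_series (X \<inter> Y) + hilbert_series (ideal_gen (X \<union> Y))) d =
      fps_nth (hilbert_series X + hilbert_series Y) d"
    unfolding fps_add_nth hilbert_series_nth by (metis of_nat_add)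
qed

lemma ideal_gen_Un_ideal_gen: "ideal_gen (ideal_gen A \<union> ideal_gen B) = ideal_gen (A \<union> B)"
  unfolding ideal_gen_eq_span ideal.span_Un ideal.span_span ..

text \<open>Components of \<open>q\<close> of degree other than \<open>d\<close> are annihilated by \<open>y\<close>, hence zero.\<close>

lemma homogeneous_cancel_linear_form:
  fixes q :: "('n::finite, 'k::field) mpoly"
  assumes y: "y \<in> homogeneous_part 1" "y \<noteq> 0" and q: "y * q \<in> homogeneous_part (Suc d)"
  shows "q \<in> homogeneous_part d"
proof -
  have "hom_comp k q = 0" if "k \<noteq> d" for k
  proof -
    have "hom_comp k q * y = hom_comp (Suc k) (q * y)" using hom_comp_mult[OF y(1), of "Suc k" q] by simp
    also have "\<dots> = 0" using hom_comp_eq[OF q, of "Suc k"] that by (simp add: mult.commute)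
    finally show ?thesis using y(2) mpoly_no_zero_divisors[of y "hom_comp k q"] by (simp add: mult.commute)
  qed
  then have "Poly_Mapping.lookup q e = 0" if "mdeg e \<noteq> d" for e
    using that lookup_hom_comp[of "mdeg e" q e] by simp
  then show ?thesis by (auto simp: homogeneous_part_def in_keys_iff)
qed

lemma hilbert_series_mult_image:
  fixes Z :: "('n::finite, 'k::field) mpoly set"
  assumes y: "y \<in> homogeneous_part 1" "y \<noteq> 0"
  shows "hilbert_series ((*) y ` Z) = fps_X * hilbert_series Z"
proof (rule fps_ext)
  fix d
  show "fps_nth (hilbert_series ((*) y ` Z)) d = fps_nth (fps_X * hilbert_series Z) d"
  proof (cases d)
    case 0
    have "p = 0" if p: "p \<in> (*) y ` Z" "p \<in> homogeneous_part 0" for p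
    proof -
      obtain q where "p = q * y" using p(1) by (auto simp: mult.commute)
      then have "hom_comp 0 p = 0" using hom_comp_mult[OF y(1), of 0 q] by simp
      then show ?thesis using hom_comp_eq[OF p(2), of 0] by simp
    qed
    then have "(*) y ` Z \<inter> homogeneous_part 0 \<subseteq> P.span {}" by auto
    then have "P.dim ((*) y ` Z \<inter> homogeneous_part 0) \<le> card ({} :: ('n, 'k) mpoly set)"
      by (intro P.dim_le_card) auto
    then show ?thesis using 0 by (simp add: hilbert_series_nth)
  next
    case (Suc k)
    have "(*) y ` Z \<inter> homogeneous_part (Suc k) = (*) y ` (Z \<inter> homogeneous_part k)"
      using homogeneous_cancel_linear_form[OF y] homogeneous_part_mult[OF y(1), of _ k] by auto
    moreover have "Vector_Spaces.linear poly_scale poly_scale ((*) y)"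
      by unfold_locales (simp_all add: algebra_simps poly_scale_conv)
    moreover have "inj ((*) y)"
    proof (rule injI)
      fix p q assume "y * p = y * q"
      then have "y * (p - q) = 0" by (simp add: right_diff_distrib)
      then show "p = q" using mpoly_no_zero_divisors y(2) by fastforce
    qed
    ultimately show ?thesis
      using Suc P.dim_injective_image[of "(*) y" "Z \<inter> homogeneous_part k"] by (simp add: hilbert_series_nth)
  qed
qed

text \<open>
  The quotient by \<open>(B)\<close> is a polynomial ring, hence a domain: the projection \<open>h\<close> that kills \<open>B\<close> and fixes
  \<open>y\<close> turns \<open>y q \<in> (B)\<close> into \<open>y h q = 0\<close>.
\<close>

lemma linear_form_nonzero_divisor:
  fixes y :: "('n::finite, 'k::field) mpoly"
  assumes B: "P.independent B" "B \<subseteq> homogeneous_part 1"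
    and y: "y \<in> homogeneous_part 1" "y \<notin> P.span B" and q: "y * q \<in> ideal_gen B"
  shows "q \<in> ideal_gen B"
proof -
  have "P.independent (insert y B)" using y(2) B(1) by (rule P.independent_insertI)
  then obtain E where E: "insert y B \<subseteq> E" "E \<subseteq> homogeneous_part 1" "P.independent E" "homogeneous_part 1 \<subseteq> P.span E"
    using P.maximal_independent_subset_extend[of "insert y B" "homogeneous_part 1"] B(2) y(1) by blast
  have "B \<subseteq> E" using E by blast
  from coordinate_projection[OF E(3,2,4) this]
  obtain h where h: "ring_endomorphism h" "\<forall>v\<in>P.span (E - B). h v = v" "\<forall>v\<in>B. h v = 0"
    "\<forall>p. p - h p \<in> ideal_gen B" by blast
  have hadd: "\<And>p q. h (p + q) = h p + h q" and hmult: "\<And>p q. h (p * q) = h p * h q"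
    using h(1) by (auto simp: ring_endomorphism_def)
  have h0: "h 0 = 0" using hadd[of 0 0] by simp
  have "h p = 0" if "p \<in> ideal_gen B" for p
    using that unfolding ideal_gen_eq_span
    by (induction rule: ideal.span_induct_alt) (use h(3) h0 in \<open>auto simp: hadd hmult\<close>)
  then have "h y * h q = 0" using q hmult by metis
  moreover have "y \<in> P.span (E - B)"
    using E(1) y(2) P.span_base[of y B] by (intro P.span_base) auto
  then have "h y = y" using h(2) by blast
  moreover have "y \<noteq> 0" using y(2) P.span_zero by metis
  ultimately have "h q = 0" using mpoly_no_zero_divisors by metis
  then show ?thesis using h(4)[rule_format, of q] by simp
qed

lemma homogeneous_ideal_gen_forms:
  "G \<subseteq> homogeneous_part a \<Longrightarrow> homogeneous_ideal (ideal_gen G)"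
  by (rule homogeneous_ideal_gen) blast

text \<open>
  Since \<open>y\<close> is a nonzero divisor modulo \<open>(B)\<close>, the ideals \<open>(B)\<close> and \<open>(y)\<close> intersect in \<open>y (B)\<close>, and
  multiplication by \<open>y\<close> shifts degrees by one.
\<close>

lemma hilbert_series_insert_form:
  fixes y :: "('n::finite, 'k::field) mpoly"
  assumes B: "P.independent B" "B \<subseteq> homogeneous_part 1"
    and y: "y \<in> homogeneous_part 1" "y \<notin> P.span B"
  shows "hilbert_series (UNIV :: ('n, 'k) mpoly set) - hilbert_series (ideal_gen (insert y B)) =
    (1 - fps_X) * (hilbert_series (UNIV :: ('n, 'k) mpoly set) - hilbert_series (ideal_gen B))"
proof -
  have y0: "y \<noteq> 0" using y(2) P.span_zero by metis
  have gen_y: "ideal_gen {y} = (*) y ` UNIV"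
    by (auto simp: ideal_gen_eq_span ideal.span_singleton mult.commute)
  have "x \<in> (*) y ` ideal_gen B" if "x \<in> ideal_gen B" "x \<in> (*) y ` UNIV" for x
    using that linear_form_nonzero_divisor[OF B y] by auto
  moreover have "y * x \<in> ideal_gen B" if "x \<in> ideal_gen B" for x
    using that by (simp add: ideal_gen_eq_span ideal.span_scale)
  ultimately have Int: "ideal_gen B \<inter> ideal_gen {y} = (*) y ` ideal_gen B"
    unfolding gen_y by blast
  have sum: "ideal_gen (ideal_gen B \<union> ideal_gen {y}) = ideal_gen (insert y B)"
    by (simp add: ideal_gen_Un_ideal_gen)
  have "homogeneous_ideal (ideal_gen B)" "homogeneous_ideal (ideal_gen {y})"
    using homogeneous_ideal_gen_forms[OF B(2)] homogeneous_ideal_gen_forms[of "{y}" 1] y(1) by blast+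
  then have "hilbert_series ((*) y ` ideal_gen B) + hilbert_series (ideal_gen (insert y B)) =
      hilbert_series (ideal_gen B) + hilbert_series ((*) y ` UNIV)"
    using hilbert_series_Int_plus_sum[of "ideal_gen B" "ideal_gen {y}"]
    unfolding Int sum unfolding gen_y by blast
  then have "hilbert_series (ideal_gen (insert y B)) =
      hilbert_series (ideal_gen B) + fps_X * hilbert_series (UNIV :: ('n, 'k) mpoly set) - fps_X * hilbert_series (ideal_gen B)"
    unfolding hilbert_series_mult_image[OF y(1) y0] by (simp add: algebra_simps)
  then show ?thesis by (simp add: left_diff_distrib right_diff_distrib)
qed

lemma ideal_gen_span_forms: "G \<subseteq> P.span B \<Longrightarrow> ideal_gen G \<subseteq> ideal_gen B"
  using P_span_subset_ideal_gen[of B] unfolding ideal_gen_eq_span by (intro ideal.span_minimal) auto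

lemma hilbert_series_ideal_of_forms:
  fixes L0 :: "('n::finite, 'k::field) mpoly set"
  assumes L0: "L0 \<subseteq> homogeneous_part 1"
  shows "hilbert_series (UNIV :: ('n, 'k) mpoly set) - hilbert_series (ideal_gen L0) =
    (1 - fps_X) ^ P.dim L0 * hilbert_series (UNIV :: ('n, 'k) mpoly set)"
proof -
  obtain B where B: "B \<subseteq> L0" "P.independent B" "L0 \<subseteq> P.span B" "card B = P.dim L0"
    using P.basis_exists by blast
  have "finite B"
    using P.finite_independent_in_span[OF B(2) _ finite_monomials[of 1]] B(1) L0
    by (auto simp: homogeneous_part_eq_span)
  moreover have "B \<subseteq> homogeneous_part 1" using B L0 by blast
  ultimately have "hilbert_series (UNIV :: ('n, 'k) mpoly set) - hilbert_series (ideal_gen B) =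
      (1 - fps_X) ^ card B * hilbert_series (UNIV :: ('n, 'k) mpoly set)"
    using B(2)
  proof induction
    case empty
    have "hilbert_series ({0} :: ('n, 'k) mpoly set) = 0"
    proof (rule fps_ext)
      fix d
      have "{0} \<inter> homogeneous_part d = ({0} :: ('n, 'k) mpoly set)"
        using P.subspace_0[OF subspace_homogeneous_part] by auto
      then show "fps_nth (hilbert_series ({0} :: ('n, 'k) mpoly set)) d = fps_nth 0 d"
        by (simp add: hilbert_series_nth)
    qed
    then show ?case by (simp add: ideal_gen_eq_span)
  next
    case (insert y B)
    have ind: "P.independent B" using insert.prems(2) by (rule P.independent_mono) auto
    have "y \<notin> P.span B" using insert.prems(2) insert.hyps(2) by (simp add: P.independent_insert)
    then show ?case
      using insert ind by (simp add: hilbert_series_insert_form mult.assoc)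
  qed
  moreover have "ideal_gen B = ideal_gen L0"
    using ideal_gen_span_forms[OF B(3)] B(1) ideal.span_mono[of B L0] by (auto simp: ideal_gen_eq_span)
  ultimately show ?thesis using B(4) by simp
qed

text \<open>
  The value \<open>1 / (1 - t)\<^sup>n\<close> comes without counting monomials: the quotient by all variables is \<open>K\<close>, with
  Hilbert series \<open>1\<close>, and each of the \<open>n\<close> variables contributes a factor \<open>1 - t\<close>.
\<close>

lemma hilbert_series_UNIV:
  "(1 - fps_X) ^ CARD('n) * hilbert_series (UNIV :: ('n::finite, 'k::field) mpoly set) = 1"
proof -
  let ?m = "ideal_gen (homogeneous_part 1) :: ('n, 'k) mpoly set"
  have "hilbert_series (UNIV :: ('n, 'k) mpoly set) - hilbert_series ?m = 1"
  proof (rule fps_ext)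
    fix d
    show "fps_nth (hilbert_series (UNIV :: ('n, 'k) mpoly set) - hilbert_series ?m) d = fps_nth 1 d"
    proof (cases d)
      case 0
      have "hom_comp 0 p = 0" if "p \<in> ?m" for p
        using that unfolding ideal_gen_eq_span
      proof (induction rule: ideal.span_induct_alt)
        case (step c x y)
        then show ?case using hom_comp_mult[of x 1 0 c] by (simp add: hom_comp_add)
      qed simp
      then have "?m \<inter> homogeneous_part 0 \<subseteq> {0}" using hom_comp_eq[of _ 0 0] by fastforce
      moreover have "0 \<in> ?m \<inter> homogeneous_part 0"
        using P.subspace_0[OF subspace_homogeneous_part] by (auto simp: ideal_gen_eq_span ideal.span_zero)
      ultimately have "?m \<inter> homogeneous_part 0 = {0}" by blast
      moreover have "P.dim (homogeneous_part 0 :: ('n, 'k) mpoly set) = 1"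
      proof -
        have "{e :: 'n \<Rightarrow>\<^sub>0 nat. mdeg e = 0} = {0}" by (auto intro: poly_mapping_eqI)
        then have "monomials 0 = {Poly_Mapping.single (0 :: 'n \<Rightarrow>\<^sub>0 nat) (1::'k)}"
          unfolding monomials_def by simp
        then show ?thesis
          unfolding homogeneous_part_eq_span P.dim_span_eq_card_independent[OF independent_monomials] by simp
      qed
      ultimately show ?thesis using 0 by (simp add: hilbert_series_nth)
    next
      case (Suc k)
      have "P.span {x * w | x w. x \<in> homogeneous_part 1 \<and> w \<in> homogeneous_part k} \<subseteq> ?m"
      proof (intro P.span_minimal ideal_subspace_imp_subspace subspace_ideal_gen subsetI)
        fix p :: "('n, 'k) mpoly" assume "p \<in> {x * w | x w. x \<in> homogeneous_part 1 \<and> w \<in> homogeneous_part k}"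
        then obtain x w where "p = x * w" and x: "x \<in> homogeneous_part 1" by blast
        then have p: "p = w * x" by (simp add: mult.commute)
        show "p \<in> ?m" unfolding p ideal_gen_eq_span using x by (intro ideal.span_scale ideal.span_base)
      qed
      then have "?m \<inter> homogeneous_part d = homogeneous_part d" using Suc homogeneous_part_Suc by blast
      then show ?thesis using Suc by (simp add: hilbert_series_nth)
    qed
  qed
  moreover have "hilbert_series (UNIV :: ('n, 'k) mpoly set) - hilbert_series ?m =
      (1 - fps_X) ^ CARD('n) * hilbert_series (UNIV :: ('n, 'k) mpoly set)"
    using hilbert_series_ideal_of_forms[of "homogeneous_part 1 :: ('n, 'k) mpoly set"] dim_homogeneous_part_1[where 'n='n and 'k='k]
    by simp
  ultimately show ?thesis by simp
qed

section \<open>Hilbert series of products of linear ideals\<close>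

definition fps_is_poly :: "rat fps \<Rightarrow> bool" where
  "fps_is_poly F \<longleftrightarrow> (\<exists>p. F = fps_of_poly p)"

lemma fps_is_poly_add: "fps_is_poly F \<Longrightarrow> fps_is_poly G \<Longrightarrow> fps_is_poly (F + G)"
  and fps_is_poly_diff: "fps_is_poly F \<Longrightarrow> fps_is_poly G \<Longrightarrow> fps_is_poly (F - G)"
  and fps_is_poly_mult: "fps_is_poly F \<Longrightarrow> fps_is_poly G \<Longrightarrow> fps_is_poly (F * G)"
  unfolding fps_is_poly_def
  by (metis fps_of_poly_add, metis fps_of_poly_diff, metis fps_of_poly_mult)

lemma fps_is_poly_1: "fps_is_poly 1" and fps_is_poly_0: "fps_is_poly 0" and fps_is_poly_X: "fps_is_poly fps_X"
  unfolding fps_is_poly_def by (metis fps_of_poly_1, metis fps_of_poly_0, metis fps_of_poly_fps_X)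

lemma fps_is_poly_power: "fps_is_poly F \<Longrightarrow> fps_is_poly (F ^ k)"
  by (induction k) (auto intro: fps_is_poly_1 fps_is_poly_mult)

lemma fps_is_poly_eventually_eq:
  assumes "\<exists>D. \<forall>d\<ge>D. fps_nth F d = fps_nth G d"
  shows "fps_is_poly (F - G)"
proof -
  obtain D where D: "\<And>d. d \<ge> D \<Longrightarrow> fps_nth F d = fps_nth G d" using assms by blast
  have "F - G = fps_of_poly (Abs_poly (fps_nth (F - G)))"
    by (rule fps_ext) (simp add: coeff_Abs_poly[of D] D)
  then show ?thesis unfolding fps_is_poly_def by blast
qed

text \<open>
  Capping the exponent at \<open>n\<close> is harmless: from \<open>(1 - t)\<^sup>n\<close> on, powers of \<open>1 - t\<close> times the Hilbert series
  of \<open>K[V]\<close> are polynomials.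
\<close>

lemma fps_is_poly_min_power:
  "fps_is_poly ((1 - fps_X) ^ min CARD('n) k * hilbert_series (UNIV :: ('n::finite, 'k::field) mpoly set) -
     (1 - fps_X) ^ k * hilbert_series (UNIV :: ('n, 'k) mpoly set))"
proof (cases "k \<le> CARD('n)")
  case True then show ?thesis by (simp add: min_def fps_is_poly_0)
next
  case False
  then have "(1 - fps_X) ^ k * hilbert_series (UNIV :: ('n, 'k) mpoly set) =
      (1 - fps_X) ^ (k - CARD('n)) * ((1 - fps_X) ^ CARD('n) * hilbert_series (UNIV :: ('n, 'k) mpoly set))"
    by (simp add: power_add[symmetric] mult.assoc[symmetric])
  then show ?thesis
    using False by (simp add: hilbert_series_UNIV fps_is_poly_diff fps_is_poly_power fps_is_poly_1 fps_is_poly_X min_def)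
qed

lemma form_products_homogeneous:
  assumes "finite A" "\<And>i. i \<in> A \<Longrightarrow> L i \<subseteq> homogeneous_part 1"
  shows "form_products A L \<subseteq> homogeneous_part (card A)"
  using assms
proof (induction A)
  case empty then show ?case by (simp add: homogeneous_part_def)
next
  case (insert i A)
  have "x * y \<in> homogeneous_part (Suc (card A))" if "x \<in> L i" "y \<in> form_products A L" for x y
    using homogeneous_part_mult[of x 1 y "card A"] insert that by auto
  then show ?case using insert by (auto simp: form_products_insert)
qed

lemma product_ideal_mod_homogeneous:
  assumes "finite A" "transversal_forms A L L0 c c0"
  shows "homogeneous_ideal (product_ideal_mod A L L0)"
  unfolding product_ideal_mod_def
  using assms form_products_homogeneous[of A L] 
  by (intro homogeneous_ideal_gen) (auto simp: transversal_forms_def)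

text \<open>
  Induction over all \<open>L0\<close> at once. In large degrees the ideal for \<open>insert m A\<close> is the intersection of the
  one for \<open>A\<close> with \<open>(L m \<union> L0)\<close>, and the sum of these two is the ideal for \<open>A\<close> relative to
  \<open>L m \<union> L0\<close>. The modular law and the induction hypotheses for \<open>L0\<close> and \<open>L m \<union> L0\<close> then give the factor
  \<open>1 - (1 - t)\<^bsup>c m\<^esup>\<close>.
\<close>

lemma hilbert_series_product_ideal_mod:
  fixes L :: "'i \<Rightarrow> ('n::finite, 'k::field) mpoly set"
  assumes "finite A" "transversal_forms A L L0 c c0"
  shows "fps_is_poly (hilbert_series (product_ideal_mod A L L0) - (hilbert_series (ideal_gen L0) +
    (\<Prod>i\<in>A. 1 - (1 - fps_X) ^ c i) * ((1 - fps_X) ^ c0 * hilbert_series (UNIV :: ('n, 'k) mpoly set))))"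
  using assms
proof (induction A arbitrary: L0 c0)
  case empty
  then have "L0 \<subseteq> homogeneous_part 1" "P.dim L0 = min CARD('n) c0"
    by (auto simp: transversal_forms_def)
  then have "hilbert_series (UNIV :: ('n, 'k) mpoly set) - hilbert_series (ideal_gen L0) =
    (1 - fps_X) ^ min CARD('n) c0 * hilbert_series (UNIV :: ('n, 'k) mpoly set)"
    by (metis hilbert_series_ideal_of_forms)
  then have "hilbert_series (UNIV :: ('n, 'k) mpoly set) -
      (hilbert_series (ideal_gen L0) + (1 - fps_X) ^ c0 * hilbert_series (UNIV :: ('n, 'k) mpoly set)) =
      (1 - fps_X) ^ min CARD('n) c0 * hilbert_series (UNIV :: ('n, 'k) mpoly set) -
      (1 - fps_X) ^ c0 * hilbert_series (UNIV :: ('n, 'k) mpoly set)"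
    unfolding diff_diff_eq[symmetric] by (rule arg_cong)
  then show ?case
    using fps_is_poly_min_power[where 'n='n and 'k='k, of c0]
    by (simp only: product_ideal_mod_empty prod.empty mult_1)
next
  case (insert m A)
  let ?U = "hilbert_series (UNIV :: ('n, 'k) mpoly set)"
  let ?F = "\<Prod>i\<in>A. 1 - (1 - fps_X) ^ c i :: rat fps"
  let ?Q = "product_ideal_mod A L L0" and ?I = "ideal_gen (L m \<union> L0)"
  have T: "transversal_forms A L L0 c c0"
    using insert.prems by (rule transversal_forms_subset) auto
  have L: "L0 \<subseteq> homogeneous_part 1" "\<And>i. i \<in> insert m A \<Longrightarrow> L i \<subseteq> homogeneous_part 1"
    and dims: "\<And>S. S \<subseteq> insert m A \<Longrightarrow> P.dim (L0 \<union> (\<Union>i\<in>S. L i)) = min CARD('n) (c0 + sum c S)"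
    using insert.prems by (auto simp: transversal_forms_def)
  have T': "transversal_forms A L (L m \<union> L0) c (c0 + c m)"
    unfolding transversal_forms_def
  proof (intro conjI allI impI)
    show "L m \<union> L0 \<subseteq> homogeneous_part 1" "\<forall>i\<in>A. L i \<subseteq> homogeneous_part 1" using L by auto
    fix S assume S: "S \<subseteq> A"
    have "L m \<union> L0 \<union> (\<Union>i\<in>S. L i) = L0 \<union> (\<Union>i\<in>insert m S. L i)" by auto
    moreover have "finite S" "m \<notin> S" using S insert.hyps finite_subset by auto
    ultimately show "P.dim (L m \<union> L0 \<union> (\<Union>i\<in>S. L i)) = min CARD('n) (c0 + c m + sum c S)"
      using dims[of "insert m S"] S by (simp add: add.assoc subset_insertI2)
  qed
  have hI: "homogeneous_ideal ?I" using L by (intro homogeneous_ideal_gen_forms[of _ 1]) auto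
  have "ideal_gen (?Q \<union> ?I) = product_ideal_mod A L (L m \<union> L0)"
    unfolding product_ideal_mod_def ideal_gen_Un_ideal_gen by (simp add: Un_ac)
  then have mod_law: "hilbert_series (?Q \<inter> ?I) + hilbert_series (product_ideal_mod A L (L m \<union> L0)) =
      hilbert_series ?Q + hilbert_series ?I"
    using hilbert_series_Int_plus_sum[OF product_ideal_mod_homogeneous[OF insert.hyps(1) T] hI] by simp
  obtain D where D: "\<And>d. d \<ge> D \<Longrightarrow> product_ideal_mod (insert m A) L L0 \<inter> homogeneous_part d =
      (\<Inter>i\<in>insert m A. ideal_gen (L i \<union> L0)) \<inter> homogeneous_part d"
    using product_eventually_eq_INT[of "insert m A" L L0 c c0] insert by auto
  have "product_ideal_mod (insert m A) L L0 \<inter> homogeneous_part d = ?Q \<inter> ?I \<inter> homogeneous_part d"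
    if "d \<ge> D" for d
  proof -
    have "?Q \<inter> ?I \<subseteq> (\<Inter>i\<in>insert m A. ideal_gen (L i \<union> L0))"
      using product_ideal_mod_subset[OF insert.hyps(1), of _ L L0] by blast
    moreover have "product_ideal_mod (insert m A) L L0 \<subseteq> ?Q \<inter> ?I"
      using product_ideal_mod_insert_subset[OF insert.hyps] by blast
    ultimately show ?thesis using D[OF that] by blast
  qed
  then have 1: "fps_is_poly (hilbert_series (product_ideal_mod (insert m A) L L0) - hilbert_series (?Q \<inter> ?I))"
    by (intro fps_is_poly_eventually_eq exI[of _ D]) (simp add: hilbert_series_nth)
  have 2: "fps_is_poly (hilbert_series ?Q - (hilbert_series (ideal_gen L0) + ?F * ((1 - fps_X) ^ c0 * ?U)))"
    using T by (rule insert.IH)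
  have 3: "fps_is_poly (hilbert_series (product_ideal_mod A L (L m \<union> L0)) -
      (hilbert_series ?I + ?F * ((1 - fps_X) ^ (c0 + c m) * ?U)))"
    using T' by (rule insert.IH)
  have "?F * (1 - (1 - fps_X) ^ c m) * ((1 - fps_X) ^ c0 * ?U) =
      ?F * ((1 - fps_X) ^ c0 * ?U) - ?F * ((1 - fps_X) ^ (c0 + c m) * ?U)"
    by (simp add: power_add algebra_simps)
  moreover have "hilbert_series (?Q \<inter> ?I) = hilbert_series ?Q + hilbert_series ?I -
      hilbert_series (product_ideal_mod A L (L m \<union> L0))"
    using mod_law by (simp add: algebra_simps)
  ultimately have split: "hilbert_series (product_ideal_mod (insert m A) L L0) - (hilbert_series (ideal_gen L0) +
      ?F * (1 - (1 - fps_X) ^ c m) * ((1 - fps_X) ^ c0 * ?U)) =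
    (hilbert_series (product_ideal_mod (insert m A) L L0) - hilbert_series (?Q \<inter> ?I)) +
    (hilbert_series ?Q - (hilbert_series (ideal_gen L0) + ?F * ((1 - fps_X) ^ c0 * ?U))) -
    (hilbert_series (product_ideal_mod A L (L m \<union> L0)) -
      (hilbert_series ?I + ?F * ((1 - fps_X) ^ (c0 + c m) * ?U)))"
    by simp
  have prod: "(\<Prod>i\<in>insert m A. 1 - (1 - fps_X) ^ c i) = ?F * (1 - (1 - fps_X) ^ c m)"
    using insert.hyps by (simp add: mult.commute)
  show ?case unfolding prod split by (rule fps_is_poly_diff[OF fps_is_poly_add[OF 1 2] 3])
qed

section \<open>Linear forms vanishing on subspaces\<close>

definition vanishing_forms ::
  "('k::field \<Rightarrow> 'v::ab_group_add \<Rightarrow> 'v) \<Rightarrow> ('n::finite \<Rightarrow> 'v) \<Rightarrow> 'v set \<Rightarrow> ('n, 'k) mpoly set" where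
  "vanishing_forms scale b W = {linear_form_poly b \<phi> |\<phi>.
     Vector_Spaces.linear scale (*) \<phi> \<and> (\<forall>v\<in>W. \<phi> v = 0)}"

lemma linear_ideal_eq: "linear_ideal scale b W = ideal_gen (vanishing_forms scale b W)"
  by (simp add: linear_ideal_def vanishing_forms_def)

lemma linear_form_poly_eq: "linear_form_poly b \<phi> = (\<Sum>i\<in>UNIV. poly_scale (\<phi> (b i)) (var_poly i))"
  by (simp add: linear_form_poly_def poly_scale_conv)

lemma linear_form_poly_in: "linear_form_poly b \<phi> \<in> homogeneous_part 1"
  unfolding linear_form_poly_eq
  using var_poly_in by (intro P.subspace_sum P.subspace_scale subspace_homogeneous_part)

lemma vanishing_forms_subset: "vanishing_forms scale b W \<subseteq> homogeneous_part 1"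
  using linear_form_poly_in by (fastforce simp: vanishing_forms_def)

lemma vanishing_forms_antimono: "W \<subseteq> W' \<Longrightarrow> vanishing_forms scale b W' \<subseteq> vanishing_forms scale b W"
  by (fastforce simp: vanishing_forms_def)

locale coordinates = V: finite_dimensional_vector_space scale "range b"
  for scale :: "'k::field \<Rightarrow> 'v::ab_group_add \<Rightarrow> 'v" and b :: "'n::finite \<Rightarrow> 'v" +
  assumes inj_b: "inj b"
begin

text \<open>The element of the basis of linear forms dual to \<open>E\<close> that takes the value \<open>1\<close> at \<open>e\<close>.\<close>

definition dual_form :: "'v set \<Rightarrow> 'v \<Rightarrow> ('n, 'k) mpoly" where
  "dual_form E e = linear_form_poly b (\<lambda>v. V.representation E v e)"

lemma dual_form_vanishes:
  assumes E: "V.independent E" "V.span E = UNIV" and B: "B \<subseteq> E" "e \<in> E - B"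
  shows "dual_form E e \<in> vanishing_forms scale b (V.span B)"
proof -
  have "V.representation E v e = 0" if "v \<in> V.span B" for v
  proof -
    have "V.representation E v = V.representation B v" using E(1) that B(1) by (rule V.representation_extend)
    then show ?thesis using V.representation_ne_zero[of B v e] B(2) by auto
  qed
  then have zero: "\<forall>v\<in>V.span B. V.representation E v e = 0" by blast
  show ?thesis
    unfolding vanishing_forms_def dual_form_def mem_Collect_eq
    by (rule exI[of _ "\<lambda>v. V.representation E v e"])
      (rule conjI[OF refl conjI[OF V.linear_representation[OF E] zero]])
qed

lemma linear_form_expansion:
  assumes E: "V.independent E" "V.span E = UNIV" and \<phi>: "Vector_Spaces.linear scale (*) \<phi>"
  shows "linear_form_poly b \<phi> = (\<Sum>e\<in>E. poly_scale (\<phi> e) (dual_form E e))"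
proof -
  interpret \<phi>: Vector_Spaces.linear scale "(*)" \<phi> by (rule \<phi>)
  have fin: "finite E" using E(1) by (rule V.finiteI_independent)
  have expand: "\<phi> v = (\<Sum>e\<in>E. V.representation E v e * \<phi> e)" for v
  proof -
    have "v = (\<Sum>e\<in>E. scale (V.representation E v e) e)"
      using V.sum_representation_eq[OF E(1) _ fin, of v] E(2) by simp
    then have "\<phi> v = \<phi> (\<Sum>e\<in>E. scale (V.representation E v e) e)" by (rule arg_cong)
    then show ?thesis by (simp add: \<phi>.sum \<phi>.scale)
  qed
  have "poly_scale (\<phi> (b i)) (var_poly i) =
      (\<Sum>e\<in>E. poly_scale (V.representation E (b i) e * \<phi> e) (var_poly i))" for i
    unfolding expand[of "b i"] by (rule P.scale_sum_left)
  then have "linear_form_poly b \<phi> =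
      (\<Sum>i\<in>UNIV. \<Sum>e\<in>E. poly_scale (V.representation E (b i) e * \<phi> e) (var_poly i))"
    unfolding linear_form_poly_eq by (intro sum.cong refl)
  also have "\<dots> = (\<Sum>e\<in>E. \<Sum>i\<in>UNIV. poly_scale (\<phi> e) (poly_scale (V.representation E (b i) e) (var_poly i)))"
    by (subst sum.swap) (simp add: mult.commute)
  also have "\<dots> = (\<Sum>e\<in>E. poly_scale (\<phi> e) (dual_form E e))"
    by (simp add: dual_form_def linear_form_poly_eq P.scale_sum_right)
  finally show ?thesis .
qed

lemma span_basis: "V.span (range b) = UNIV" and independent_basis: "V.independent (range b)"
  by (fact V.span_Basis V.independent_Basis)+

lemma dim_V: "V.dim UNIV = CARD('n)"
  using inj_b by (simp add: card_image)

lemma vanishing_forms_subset_span: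
  assumes E: "V.independent E" "V.span E = UNIV" and B: "B \<subseteq> E" "V.span B = W"
  shows "vanishing_forms scale b W \<subseteq> P.span (dual_form E ` (E - B))"
proof
  fix y assume "y \<in> vanishing_forms scale b W"
  then obtain \<phi> where \<phi>: "y = linear_form_poly b \<phi>" "Vector_Spaces.linear scale (*) \<phi>" "\<forall>v\<in>W. \<phi> v = 0"
    by (auto simp: vanishing_forms_def)
  have "poly_scale (\<phi> e) (dual_form E e) \<in> P.span (dual_form E ` (E - B))" if "e \<in> E" for e
  proof (cases "e \<in> B")
    case True
    then have "\<phi> e = 0" using \<phi>(3) B(2) V.span_base by blast
    then show ?thesis by (simp add: P.span_zero)
  next
    case False then show ?thesis using that by (intro P.span_scale P.span_base) auto
  qed
  then show "y \<in> P.span (dual_form E ` (E - B))"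
    unfolding \<phi>(1) linear_form_expansion[OF E \<phi>(2)] by (intro P.span_sum)
qed

lemma extend_to_basis:
  assumes "V.independent B"
  obtains E where "B \<subseteq> E" "V.independent E" "V.span E = UNIV"
proof -
  obtain E where "B \<subseteq> E" "V.independent E" "UNIV \<subseteq> V.span E"
    using V.maximal_independent_subset_extend[OF subset_UNIV assms] by metis
  then show ?thesis using that[of E] by auto
qed

text \<open>
  For a basis \<open>E\<close> of \<open>V\<close> extending a basis \<open>B\<close> of \<open>W\<close>, the dual forms of \<open>E - B\<close> span the forms vanishing
  on \<open>W\<close>. They are independent by counting: together with the dual forms of \<open>B\<close> they are \<open>n\<close> elements
  spanning the \<open>n\<close>-dimensional space of linear forms.
\<close>

lemma dim_vanishing_forms:
  assumes W: "V.subspace W"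
  shows "P.dim (vanishing_forms scale b W) = codim scale W"
proof -
  obtain B where B: "B \<subseteq> W" "V.independent B" "W \<subseteq> V.span B" "card B = V.dim W"
    using V.basis_exists by blast
  have sB: "V.span B = W" using B W by (metis V.span_subspace)
  obtain E where E: "B \<subseteq> E" "V.independent E" "V.span E = UNIV" using extend_to_basis[OF B(2)] .
  have fin: "finite E" using E(2) by (rule V.finiteI_independent)
  have cardE: "card E = CARD('n)"
    using V.dim_span_eq_card_independent[OF E(2)] E(3) dim_V by simp
  let ?Y1 = "dual_form E ` B" and ?Y2 = "dual_form E ` (E - B)"
  have Y: "?Y1 \<subseteq> homogeneous_part 1" "?Y2 \<subseteq> homogeneous_part 1"
    using linear_form_poly_in by (auto simp: dual_form_def)
  have le: "P.dim ?Y1 \<le> card B" "P.dim ?Y2 \<le> card (E - B)"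
    using P.dim_le_card[OF P.span_superset, of ?Y1] P.dim_le_card[OF P.span_superset, of ?Y2]
      card_image_le[of B "dual_form E"] card_image_le[of "E - B" "dual_form E"] fin finite_subset[OF E(1) fin]
    by (auto intro: order_trans)
  have "var_poly i \<in> P.span (?Y1 \<union> ?Y2)" for i
  proof -
    let ?\<phi> = "\<lambda>v. V.representation (range b) v (b i)"
    have "linear_form_poly b ?\<phi> = (\<Sum>j\<in>UNIV. if j = i then var_poly i else 0)"
      unfolding linear_form_poly_eq using inj_b
      by (intro sum.cong refl) (auto simp: V.representation_basis[OF independent_basis] inj_eq)
    then have "var_poly i = linear_form_poly b ?\<phi>" by simp
    also have "\<dots> = (\<Sum>e\<in>E. poly_scale (?\<phi> e) (dual_form E e))"
      by (intro linear_form_expansion E V.linear_representation independent_basis span_basis)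
    also have "\<dots> \<in> P.span (?Y1 \<union> ?Y2)" by (intro P.span_sum P.span_scale P.span_base) auto
    finally show ?thesis .
  qed
  then have "homogeneous_part 1 \<subseteq> P.span (?Y1 \<union> ?Y2)"
    unfolding homogeneous_part_1_eq_span by (intro P.span_minimal) auto
  then have "CARD('n) \<le> P.dim (?Y1 \<union> ?Y2)"
    using P.dim_mono_finite[OF _ _ finite_monomials[of 1], of "homogeneous_part 1" "?Y1 \<union> ?Y2"] Y
    by (simp add: homogeneous_part_eq_span[symmetric] dim_homogeneous_part_1[simplified])
  also have "\<dots> \<le> P.dim ?Y1 + P.dim ?Y2"
    using P.dim_Un_plus_dim_Int[OF finite_monomials[of 1], of ?Y1 ?Y2] Y
    by (simp add: homogeneous_part_eq_span[symmetric])
  finally have "P.dim ?Y2 = card (E - B)"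
    using le cardE card_Diff_subset[OF finite_subset[OF E(1) fin] E(1)] card_mono[OF fin E(1)] by linarith
  moreover have "P.span (vanishing_forms scale b W) = P.span ?Y2"
  proof (rule subset_antisym)
    show "P.span (vanishing_forms scale b W) \<subseteq> P.span ?Y2"
      using vanishing_forms_subset_span[OF E(2,3,1) sB] by (intro P.span_minimal) auto
    show "P.span ?Y2 \<subseteq> P.span (vanishing_forms scale b W)"
      using dual_form_vanishes[OF E(2,3,1)] sB by (intro P.span_mono) blast
  qed
  then have "P.dim (vanishing_forms scale b W) = P.dim ?Y2" by (metis P.dim_span)
  ultimately show ?thesis
    using cardE B(4) card_Diff_subset[OF finite_subset[OF E(1) fin] E(1)] dim_V by (simp add: codim_def)
qed

text \<open>
  With a basis \<open>E\<close> of \<open>V\<close> that contains bases \<open>C\<close>, \<open>D\<close> of \<open>W1\<close>, \<open>W2\<close> and \<open>C \<inter> D\<close> of \<open>W1 \<inter> W2\<close>, the dual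
  form of an element outside \<open>C \<inter> D\<close> vanishes on \<open>W1\<close> or on \<open>W2\<close>.
\<close>

lemma vanishing_forms_Int:
  assumes "V.subspace W1" "V.subspace W2"
  shows "vanishing_forms scale b (W1 \<inter> W2) \<subseteq> P.span (vanishing_forms scale b W1 \<union> vanishing_forms scale b W2)"
proof -
  obtain C D where CD: "V.independent (C \<union> D)" "V.span C = W1" "V.span D = W2" "V.span (C \<inter> D) = W1 \<inter> W2"
    using V.adapted_bases[OF assms] by blast
  obtain E where E: "C \<union> D \<subseteq> E" "V.independent E" "V.span E = UNIV" using extend_to_basis[OF CD(1)] .
  have "C \<inter> D \<subseteq> E" "C \<subseteq> E" "D \<subseteq> E" using E(1) by auto
  then have "dual_form E ` (E - C \<inter> D) \<subseteq> vanishing_forms scale b W1 \<union> vanishing_forms scale b W2"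
    using dual_form_vanishes[OF E(2,3), of C] dual_form_vanishes[OF E(2,3), of D] CD(2,3) by blast
  then show ?thesis
    using vanishing_forms_subset_span[OF E(2,3) \<open>C \<inter> D \<subseteq> E\<close> CD(4)] P.span_mono by blast
qed

lemma vanishing_forms_UNIV: "vanishing_forms scale b UNIV = {0}"
proof -
  have "Vector_Spaces.linear scale (*) (\<lambda>v. 0)"
    by unfold_locales (simp_all add: algebra_simps)
  then show ?thesis by (auto simp: vanishing_forms_def linear_form_poly_eq intro!: exI[of _ "\<lambda>v. 0"])
qed

lemma span_vanishing_forms_INT:
  assumes "finite S" "\<And>i. i \<in> S \<Longrightarrow> V.subspace (W i)"
  shows "P.span (\<Union>i\<in>S. vanishing_forms scale b (W i)) = P.span (vanishing_forms scale b (\<Inter>i\<in>S. W i))"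
proof (rule subset_antisym)
  show "P.span (\<Union>i\<in>S. vanishing_forms scale b (W i)) \<subseteq> P.span (vanishing_forms scale b (\<Inter>i\<in>S. W i))"
    using vanishing_forms_antimono[of "\<Inter>i\<in>S. W i"] by (intro P.span_mono) blast
  have "vanishing_forms scale b (\<Inter>i\<in>S. W i) \<subseteq> P.span (\<Union>i\<in>S. vanishing_forms scale b (W i))"
    using assms
  proof (induction S)
    case empty then show ?case by (simp add: vanishing_forms_UNIV)
  next
    case (insert j S)
    have "vanishing_forms scale b (W j \<inter> (\<Inter>i\<in>S. W i)) \<subseteq>
        P.span (vanishing_forms scale b (W j) \<union> vanishing_forms scale b (\<Inter>i\<in>S. W i))"
      using insert.prems by (intro vanishing_forms_Int V.subspace_Int) auto
    also have "\<dots> \<subseteq> P.span (\<Union>i\<in>insert j S. vanishing_forms scale b (W i))"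
    proof (rule P.span_minimal)
      have "P.span (\<Union>i\<in>S. vanishing_forms scale b (W i)) \<subseteq> P.span (\<Union>i\<in>insert j S. vanishing_forms scale b (W i))"
        by (intro P.span_mono) auto
      moreover have "vanishing_forms scale b (W j) \<subseteq> P.span (\<Union>i\<in>insert j S. vanishing_forms scale b (W i))"
        using P.span_superset[of "\<Union>i\<in>insert j S. vanishing_forms scale b (W i)"] by auto
      ultimately show "vanishing_forms scale b (W j) \<union> vanishing_forms scale b (\<Inter>i\<in>S. W i) \<subseteq>
          P.span (\<Union>i\<in>insert j S. vanishing_forms scale b (W i))"
        using insert by auto
    qed simp
    finally show ?case by simp
  qed
  then show "P.span (vanishing_forms scale b (\<Inter>i\<in>S. W i)) \<subseteq> P.span (\<Union>i\<in>S. vanishing_forms scale b (W i))"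
    by (intro P.span_minimal) auto
qed

lemma transversal_imp_transversal_forms:
  assumes A: "finite A" "\<And>i. i \<in> A \<Longrightarrow> V.subspace (W i)" and T: "transversal scale A W"
  shows "transversal_forms A (\<lambda>i. vanishing_forms scale b (W i)) {} (\<lambda>i. codim scale (W i)) 0"
  unfolding transversal_forms_def
proof (intro conjI ballI allI impI vanishing_forms_subset)
  fix S assume S: "S \<subseteq> A"
  then have fin: "finite S" using A(1) finite_subset by blast
  have "P.dim (\<Union>i\<in>S. vanishing_forms scale b (W i)) = P.dim (vanishing_forms scale b (\<Inter>i\<in>S. W i))"
  proof -
    have "\<And>i. i \<in> S \<Longrightarrow> V.subspace (W i)" using S A(2) by blast
    then show ?thesis by (intro P.span_eq_dim span_vanishing_forms_INT fin)
  qed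
  also have "\<dots> = codim scale (\<Inter>i\<in>S. W i)"
    using S A(2) by (intro dim_vanishing_forms V.subspace_Int) auto
  also have "\<dots> = min CARD('n) (\<Sum>i\<in>S. codim scale (W i))"
    using T S dim_V by (simp add: transversal_def)
  finally show "P.dim ({} \<union> (\<Union>i\<in>S. vanishing_forms scale b (W i))) =
    min CARD('n) (0 + (\<Sum>i\<in>S. codim scale (W i)))" by simp
qed simp

end

theorem theorem4p6:
  fixes scale :: "'k::field \<Rightarrow> 'v::ab_group_add \<Rightarrow> 'v"
    and b :: "'n::finite \<Rightarrow> 'v"
    and V :: "nat \<Rightarrow> 'v set"
    and n m :: nat
    and f :: "rat fps"
  assumes "finite_dimensional_vector_space scale (range b)" and "inj b"
    and "n = vector_space.dim scale UNIV" and "n \<ge> 1"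
    and "m \<ge> 1"
    and "\<And>i. i \<in> {1..m} \<Longrightarrow> module.subspace scale (V i)"
    and "transversal scale {1..m} V"
    and "f = (\<Prod>i=1..m. 1 - (1 - fps_X) ^ codim scale (V i)) / (1 - fps_X) ^ n"
  shows "(\<exists>p. hilbert_series (\<Inter>i\<in>{1..m}. linear_ideal scale b (V i)) - f = fps_of_poly p) \<and>
         (\<exists>q. hilbert_series (ideal_product {1..m} (\<lambda>i. linear_ideal scale b (V i))) - f = fps_of_poly q)"
proof -
  interpret coordinates scale b
    using assms(1,2) by (simp add: coordinates_def coordinates_axioms_def)
  let ?A = "{1..m}" and ?L = "\<lambda>i. vanishing_forms scale b (V i)"
  let ?F = "\<Prod>i=1..m. 1 - (1 - fps_X) ^ codim scale (V i) :: rat fps"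
  let ?U = "hilbert_series (UNIV :: ('n, 'k) mpoly set)"
  let ?I = "\<Inter>i\<in>?A. linear_ideal scale b (V i)"
  let ?J = "ideal_product ?A (\<lambda>i. linear_ideal scale b (V i))"
  have T: "transversal_forms ?A ?L {} (\<lambda>i. codim scale (V i)) 0"
    using assms(6,7) by (intro transversal_imp_transversal_forms) auto
  \<comment> \<open>The quotient \<open>f\<close> is a genuine one, because \<open>1 - t\<close> has constant term \<open>1\<close> and is a unit; multiplying by
    the denominator identifies \<open>f\<close> with \<open>F\<close> times the Hilbert series of \<open>K[V]\<close>.\<close>
  have "n = CARD('n)" using assms(3) dim_V by simp
  then have "f * (1 - fps_X) ^ n = (?F * ?U) * (1 - fps_X) ^ n"
  proof -
    have "((1 - fps_X) ^ n :: rat fps) dvd ?F"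
      by (rule unit_imp_dvd) (simp add: fps_is_unit_iff)
    then have "f * (1 - fps_X) ^ n = ?F" unfolding assms(8) by simp
    then show ?thesis using hilbert_series_UNIV[where 'n='n and 'k='k] \<open>n = CARD('n)\<close>
      by (simp add: mult_ac)
  qed
  moreover have "((1 - fps_X) ^ n :: rat fps) \<noteq> 0"
  proof
    assume "((1 - fps_X) ^ n :: rat fps) = 0"
    then have "fps_nth (1 - fps_X :: rat fps) 0 = 0" by simp
    then show False by simp
  qed
  ultimately have f: "f = ?F * ?U" by simp
  have J: "?J = product_ideal_mod ?A ?L {}"
    by (simp add: linear_ideal_eq ideal_product_ideal_gen product_ideal_mod_def)
  have zero: "hilbert_series (ideal_gen {} :: ('n, 'k) mpoly set) = 0"
    by (rule fps_ext) (use P.subspace_0[OF subspace_homogeneous_part] in \<open>auto simp: hilbert_series_nth ideal_gen_eq_span Int_insert_left\<close>)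
  have HJ: "fps_is_poly (hilbert_series ?J - f)"
    using hilbert_series_product_ideal_mod[OF _ T] unfolding J f by (simp add: zero)
  have "\<exists>D. \<forall>d\<ge>D. ?J \<inter> homogeneous_part d = ?I \<inter> homogeneous_part d"
    using product_eventually_eq_INT[OF _ T] unfolding J by (simp add: linear_ideal_eq)
  then have "fps_is_poly (hilbert_series ?I - hilbert_series ?J)"
    by (intro fps_is_poly_eventually_eq) (metis hilbert_series_nth)
  from fps_is_poly_add[OF this HJ] HJ show ?thesis
    by (simp add: fps_is_poly_def)
qed

end
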